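(* Let $A(n)$ denote the number of anti-coprime permutations of $[n]=\{1,\dots,n\}$, i.e. permutations $\pi$ of $[n]$ such that $\gcd(j,\pi(j))>1$ for every $j\in[n]$ with $j\ne1$. Then \[ A(n)=\frac{n!}{(\log n)^{(e^{-\gamma}+o(1))n}}\quad\text{as } n\to\infty, \] where $\gamma$ is Euler's constant. *)

theory Defs
  imports
    "HOL-Analysis.Analysis"
    "HOL-Library.Landau_Symbols"
    "HOL-Combinatorics.Permutations"
begin

definition anti_coprime_perms :: "nat \<Rightarrow> (nat \<Rightarrow> nat) set" where
  "anti_coprime_perms n =
     {\<pi>. \<pi> permutes {1..n} \<and> (\<forall>j\<in>{1..n}. j \<noteq> 1 \<longrightarrow> gcd j (\<pi> j) > 1)}"

definition num_anti_coprime :: "nat \<Rightarrow> nat" where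
  "num_anti_coprime n = card (anti_coprime_perms n)"

end

theory Submission
  imports Defs "HOL-Computational_Algebra.Primes" "HOL-Real_Asymp.Real_Asymp"
begin

text \<open>
  Let \<open>P(j)\<close> be the least prime factor of \<open>j\<close> and \<open>L(n)\<close> the sum of \<open>log P(j)\<close> over \<open>2 \<le> j \<le> n\<close>.
  Only about \<open>n / P(j)\<close> values are admissible at \<open>j\<close>, up to the factor \<open>\<omega>(j)\<close>, which is harmless since
  \<open>\<omega>\<close> has average \<open>log log n + O(1)\<close>; so \<open>log A(n) \<le> n log n - L(n) + o(n log log n)\<close>.
  Conversely, every permutation that preserves \<open>P\<close> is anti-coprime, so \<open>A(n)\<close> is at least the product
  of the \<open>|S\<^sub>p|!\<close> over the fibres \<open>S\<^sub>p\<close> of \<open>P\<close>. By Gibbs' inequality with weights \<open>p\<close> to the \<open>-(1 + \<delta>)\<close>, this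
  loses at most \<open>(1 + \<delta>) L(n) + O(n)\<close> against \<open>log n!\<close>.

  It remains to see that \<open>L(n)\<close> is asymptotic to \<open>exp (-\<gamma>) n log log n\<close>. Up to \<open>O(n)\<close>, \<open>L(n) / log 2\<close> is the sum
  over \<open>k\<close> of the number of \<open>j \<le> n\<close> without prime factors up to \<open>2\<close> to the \<open>k\<close>. Rankin's sieve and
  Mertens' third theorem evaluate these counts as \<open>exp (-\<gamma>) n / (k log 2)\<close> for \<open>k\<close> up to
  \<open>log n / (log log n)\<^sup>2\<close>; the bound \<open>O(n / k)\<close> suffices for the remaining \<open>k\<close>.
\<close>

section \<open>Chebyshev's bound and Mertens' first theorem\<close>

text \<open>The accuracy needed in \<open>log A(n)\<close> is only \<open>o(n log log n)\<close>,
  and this decides the tools. In the lower bound Gibbs' inequality replaces estimates of individual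
  fibre sizes by one sum over the weights. The weights are not normalised and their sum is charged
  \<open>n\<close> times: with weights \<open>1 / p\<close> this would cost about
  \<open>n log log n\<close>, as much as the main term. Hence the convergent exponent
  \<open>1 + \<delta>\<close>, with \<delta> fixed and sent to 0 only at the very end.

  The delicate point is the constant. Partial summation from Mertens' first theorem shows that a
  limit exists but not what it is; the value is read off from zeta near 1. Grouping primes between
  powers of 2 turns the prime sums into series over \<open>k\<close>, compared there with the
  harmonic series, which is where gamma comes from.

  In the sieve, Rankin's error is negligible only while \<open>2 ^ k\<close> is a very small power
  of \<open>n\<close>. The remaining \<open>k\<close> span a factor of order
  \<open>(log log n)^2\<close>, so their \<open>1 / k\<close> add up to
  \<open>O(log log log n)\<close> and an upper bound of the right order is enough for them.\<close>

definition primes_le :: "nat \<Rightarrow> nat set" where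
  "primes_le n = {p. prime p \<and> p \<le> n}"

lemma primes_le_iff: "p \<in> primes_le n \<longleftrightarrow> prime p \<and> p \<le> n"
  by (simp add: primes_le_def)

lemma finite_primes_le [simp]: "finite (primes_le n)"
  by (simp add: primes_le_def)

lemma primes_le_mono: "m \<le> n \<Longrightarrow> primes_le m \<subseteq> primes_le n"
  by (auto simp: primes_le_def)

lemma primes_le_ge_2: "p \<in> primes_le n \<Longrightarrow> real p \<ge> 2"
  using prime_ge_2_nat[of p] by (auto simp: primes_le_iff)

lemma primes_le_1: "n \<le> 1 \<Longrightarrow> primes_le n = {}"
  using primes_le_ge_2[of _ n] by (fastforce simp: primes_le_iff)

lemma of_nat_le_div_plus_1: "p > 0 \<Longrightarrow> real n / real p \<le> real (n div p) + 1"
proof -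
  assume "p > 0"
  then have "n \<le> p * (n div p) + p" using dividend_less_times_div[of p n] by simp
  then have "real n \<le> real p * (real (n div p) + 1)"
    by (metis of_nat_le_iff of_nat_add of_nat_mult distrib_left mult.right_neutral of_nat_1)
  with \<open>p > 0\<close> show ?thesis by (simp add: divide_le_eq mult.commute)
qed

section \<open>Chebyshev's upper bound from central binomial coefficients\<close>

definition theta :: "nat \<Rightarrow> real" where
  "theta n = (\<Sum>p\<in>primes_le n. ln (real p))"

lemma prod_primes_dvd:
  fixes N :: nat
  assumes "finite A" "\<And>p. p \<in> A \<Longrightarrow> prime p" "\<And>p. p \<in> A \<Longrightarrow> p dvd N"
  shows "\<Prod>A dvd N"
  using assms
proof (induction A rule: finite_induct)
  case (insert p A)
  have "coprime p (\<Prod>A)"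
    by (rule prod_coprime_right) (metis insert insertCI primes_coprime)
  with insert show ?case
    by (simp add: divides_mult)
qed simp

text \<open>Every prime in \<open>(m, 2m]\<close> divides the numerator but not the denominator of
  the central binomial coefficient, which is at most \<open>4 ^ m\<close>.\<close>

lemma theta_double_le: "theta (2 * m) \<le> theta m + 2 * real m * ln 2"
proof -
  let ?A = "primes_le (2 * m) - primes_le m"
  have "p dvd (2 * m choose m)" if "p \<in> ?A" for p
  proof -
    from that have p: "prime p" "m < p" "p \<le> 2 * m" by (auto simp: primes_le_iff)
    have "fact m * fact m * (2 * m choose m) = (fact (2 * m) :: nat)"
      using binomial_fact_lemma[of m "2 * m"] by simp
    moreover have "p dvd (fact (2 * m) :: nat)" "\<not> p dvd (fact m :: nat)"
      using p by (auto simp: prime_dvd_fact_iff)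
    ultimately show ?thesis
      using p(1) by (metis prime_dvd_mult_iff)
  qed
  then have "\<Prod>?A dvd (2 * m choose m)"
    by (intro prod_primes_dvd) (auto simp: primes_le_iff)
  then have "\<Prod>?A \<le> (2 * m choose m)"
    by (rule dvd_imp_le) simp
  also have "\<dots> \<le> 2 ^ (2 * m)" by (rule binomial_le_pow2)
  finally have "real (\<Prod>?A) \<le> 2 ^ (2 * m)" by (metis of_nat_le_iff of_nat_numeral of_nat_power)
  moreover have pos: "real (\<Prod>?A) > 0"
    by (auto intro!: prod_pos simp: primes_le_iff prime_gt_0_nat)
  ultimately have "ln (real (\<Prod>?A)) \<le> ln (2 ^ (2 * m))"
    by (subst ln_le_cancel_iff) auto
  moreover have "ln (real (\<Prod>?A)) = (\<Sum>p\<in>?A. ln (real p))"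
    unfolding of_nat_prod by (subst ln_prod) (auto simp: primes_le_iff)
  moreover have "(\<Sum>p\<in>?A. ln (real p)) = theta (2 * m) - theta m"
    unfolding theta_def by (rule sum_diff) (simp_all add: primes_le_mono)
  ultimately show ?thesis
    by (simp add: ln_realpow)
qed

lemma theta_mono: "m \<le> n \<Longrightarrow> theta m \<le> theta n"
  unfolding theta_def
  by (rule sum_mono2) (auto simp: primes_le_mono dest: primes_le_ge_2)

lemma theta_le: "theta n \<le> 4 * real n"
proof (induction n rule: less_induct)
  case (less n)
  consider "n \<le> 1" | "n = 2" | "n \<ge> 3" by linarith
  then show ?case
  proof cases
    case 1
    then show ?thesis by (simp add: theta_def primes_le_1)
  next
    case 2
    have "theta 2 \<le> theta 1 + 2 * ln 2" using theta_double_le[of 1] by simp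
    moreover have "theta 1 = 0" by (simp add: theta_def primes_le_1)
    ultimately show ?thesis using 2 ln2_le_25_over_36 by simp
  next
    case 3
    \<comment> \<open>Halving rounds up, so the estimate to close is
      \<open>(4 + 25/18) * (n + 1) / 2 \<le> 4 * n\<close>. It holds from \<open>n = 3\<close> on
      and just fails at \<open>n = 2\<close>, hence the separate case.\<close>
    define m where "m = (n + 1) div 2"
    have m: "m < n" "n \<le> 2 * m" "2 * m \<le> n + 1" using 3 by (auto simp: m_def)
    have "theta n \<le> theta (2 * m)" by (rule theta_mono) fact
    also have "\<dots> \<le> theta m + 2 * real m * ln 2" by (rule theta_double_le)
    also have "2 * real m * ln 2 \<le> 2 * real m * (25 / 36)"
      by (intro mult_left_mono ln2_le_25_over_36) auto
    also have "theta m \<le> 4 * real m" using less m by simp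
    finally show ?thesis using m 3 by linarith
  qed
qed

section \<open>Mertens' first theorem from the prime factorization of the factorial\<close>

lemma ln_le_2_sqrt: "x \<ge> 1 \<Longrightarrow> ln x \<le> 2 * sqrt (x::real)"
proof -
  assume "x \<ge> 1"
  then have "ln x = 2 * ln (sqrt x)" by (simp add: ln_sqrt)
  also have "ln (sqrt x) \<le> sqrt x - 1" using \<open>x \<ge> 1\<close> by (intro ln_le_minus_one) simp
  finally show ?thesis by simp
qed

text \<open>The summand is the sum of \<open>ln p / p ^ a\<close> over \<open>a \<ge> 2\<close>:
  this bounds the total contribution of proper prime powers.\<close>

lemma prime_ln_square_sum_bounded:
  "\<exists>C. \<forall>n. (\<Sum>p\<in>primes_le n. ln (real p) / (real p * (real p - 1))) \<le> C"
proof -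
  have s: "summable (\<lambda>m. 4 * real m powr (-3/2))"
    by (intro summable_mult) (simp add: summable_real_powr_iff)
  show ?thesis
  proof (intro exI allI)
    fix n
    have "(\<Sum>p\<in>primes_le n. ln (real p) / (real p * (real p - 1)))
        \<le> (\<Sum>p\<in>primes_le n. 4 * real p powr (-3/2))"
    proof (rule sum_mono)
      fix p assume "p \<in> primes_le n"
      then have p: "real p \<ge> 2" by (rule primes_le_ge_2)
      have "ln (real p) / (real p * (real p - 1)) \<le> 2 * sqrt p / (real p * (real p / 2))"
        using p by (intro frac_le mult_left_mono ln_le_2_sqrt) auto
      also have "\<dots> = 4 * (sqrt p / (real p ^ 2))" by (simp add: power2_eq_square)
      also have "sqrt p / (real p ^ 2) = real p powr (1/2 - 2)"
        using p unfolding powr_diff by (simp add: powr_half_sqrt)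
      finally show "ln (real p) / (real p * (real p - 1)) \<le> 4 * real p powr (-3/2)" by simp
    qed
    also have "\<dots> \<le> (\<Sum>m. 4 * real m powr (-3/2))"
      by (intro sum_le_suminf s) auto
    finally show "(\<Sum>p\<in>primes_le n. ln (real p) / (real p * (real p - 1)))
        \<le> (\<Sum>m. 4 * real m powr (-3/2))" .
  qed
qed

lemma multiples_image:
  fixes p n :: nat assumes "p > 0"
  shows "{m\<in>{1..n}. p dvd m} = (\<lambda>m. p * m) ` {1..n div p}"
proof safe
  fix m assume m: "m \<in> {1..n}" "p dvd m"
  from m(2) obtain k where "m = p * k" unfolding dvd_def by blast
  with m assms show "m \<in> (*) p ` {1..n div p}"
    by (auto simp: less_eq_div_iff_mult_less_eq algebra_simps intro!: image_eqI[of _ _ k])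
next
  fix m assume "m \<in> {1..n div p}"
  with assms show "p * m \<in> {1..n}"
    by (auto simp: less_eq_div_iff_mult_less_eq algebra_simps)
qed auto

lemma card_multiples: "p > 0 \<Longrightarrow> card {m\<in>{1..n}. p dvd m} = n div (p::nat)"
  by (subst multiples_image) (auto simp: card_image inj_on_def)

text \<open>Legendre's formula in recursive form. The first term counts each multiple of
  \<open>p\<close> once, the second collects the higher powers; only the first belongs to Mertens'
  sum.\<close>

lemma sum_multiplicity_rec:
  assumes "prime (p::nat)"
  shows "(\<Sum>m\<in>{1..n}. multiplicity p m) = n div p + (\<Sum>m\<in>{1..n div p}. multiplicity p m)"
proof -
  have p: "p > 0" using assms prime_gt_0_nat by auto
  have "(\<Sum>m\<in>{1..n}. multiplicity p m) = (\<Sum>m\<in>{m\<in>{1..n}. p dvd m}. multiplicity p m)"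
    by (rule sum.mono_neutral_right) (auto simp: not_dvd_imp_multiplicity_0)
  also have "\<dots> = (\<Sum>m\<in>{1..n div p}. multiplicity p (p * m))"
    unfolding multiples_image[OF p] by (subst sum.reindex) (use p in \<open>auto simp: inj_on_def\<close>)
  also have "\<dots> = (\<Sum>m\<in>{1..n div p}. multiplicity p m + 1)"
  proof (rule sum.cong)
    fix m assume "m \<in> {1..n div p}"
    with assms p show "multiplicity p (p * m) = multiplicity p m + 1"
      using not_prime_unit[of p] by (subst multiplicity_times_same) auto
  qed simp
  also have "\<dots> = n div p + (\<Sum>m\<in>{1..n div p}. multiplicity p m)"
    by (subst sum.distrib) simp
  finally show ?thesis .
qed

lemma sum_multiplicity_le:
  assumes "prime (p::nat)"
  shows "real (\<Sum>m\<in>{1..n}. multiplicity p m) \<le> real n / (real p - 1)"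
proof (induction n rule: less_induct)
  case (less n)
  have p: "real p \<ge> 2" using prime_ge_2_nat[OF assms] by simp
  show ?case
  proof (cases "n = 0")
    case False
    then have "n div p < n" using prime_ge_2_nat[OF assms] by (intro div_less_dividend) auto
    then have "real (\<Sum>m\<in>{1..n}. multiplicity p m) \<le> real (n div p) + real (n div p) / (real p - 1)"
      unfolding sum_multiplicity_rec[OF assms, of n] of_nat_add by (intro add_left_mono less)
    also have "\<dots> = real (n div p) * (real p / (real p - 1))"
      using p by (simp add: field_simps)
    also have "\<dots> \<le> (real n / real p) * (real p / (real p - 1))"
      by (intro mult_right_mono of_nat_div_le_of_nat) (use p in auto)
    also have "\<dots> = real n / (real p - 1)" using p by simp
    finally show ?thesis .
  qed simp
qed

lemma ln_eq_sum_multiplicity: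
  assumes "m > 0" "m \<le> n"
  shows "ln (real m) = (\<Sum>p\<in>primes_le n. real (multiplicity p m) * ln (real p))"
proof -
  have "real m = real (\<Prod>p\<in>prime_factors m. p ^ multiplicity p m)"
    by (rule arg_cong) (rule prime_factorization_nat, fact)
  also have "\<dots> = (\<Prod>p\<in>prime_factors m. real p ^ multiplicity p m)"
    by (simp only: of_nat_prod of_nat_power)
  finally have "ln (real m) = ln (\<Prod>p\<in>prime_factors m. real p ^ multiplicity p m)"
    by (rule arg_cong)
  also have "\<dots> = (\<Sum>p\<in>prime_factors m. real (multiplicity p m) * ln (real p))"
    by (subst ln_prod) (auto simp: ln_realpow prime_gt_0_nat in_prime_factors_iff intro!: sum.cong)
  also have "\<dots> = (\<Sum>p\<in>primes_le n. real (multiplicity p m) * ln (real p))"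
  proof (rule sum.mono_neutral_left)
    show "prime_factors m \<subseteq> primes_le n"
      using assms by (auto simp: primes_le_iff in_prime_factors_iff dest!: dvd_imp_le)
    show "\<forall>p\<in>primes_le n - prime_factors m. real (multiplicity p m) * ln (real p) = 0"
      using assms by (auto simp: primes_le_iff in_prime_factors_iff not_dvd_imp_multiplicity_0)
  qed auto
  finally show ?thesis .
qed

text \<open>The defect of \<open>ln m\<close> against the sum over distinct prime divisors is
  nonnegative, and its total over \<open>{1..n}\<close> is \<open>O(n)\<close>. Nonnegativity passes
  the bound to every subset: the full interval serves Mertens' first theorem, subsets serve the
  count of rough integers.\<close>

lemma sum_ln_prime_divisors:
  "\<exists>C. \<forall>n. \<bar>(\<Sum>m\<in>{1..n}. ln (real m)) - (\<Sum>p\<in>primes_le n. ln (real p) * real (n div p))\<bar> \<le> C * real n \<and>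
    (\<forall>A\<subseteq>{1..n}. \<bar>(\<Sum>m\<in>A. ln (real m) - (\<Sum>p\<in>{p\<in>primes_le n. p dvd m}. ln (real p)))\<bar> \<le> C * real n)"
proof -
  obtain C where C: "\<And>n. (\<Sum>p\<in>primes_le n. ln (real p) / (real p * (real p - 1))) \<le> C"
    using prime_ln_square_sum_bounded by blast
  show ?thesis
  proof (intro exI[of _ C] allI)
    fix n
    define d where "d m = ln (real m) - (\<Sum>p\<in>{p\<in>primes_le n. p dvd m}. ln (real p))" for m
    have d: "d m = (\<Sum>p\<in>primes_le n. (real (multiplicity p m) - (if p dvd m then 1 else 0)) * ln (real p))"
      if "m \<in> {1..n}" for m
      using that unfolding d_def
      by (subst ln_eq_sum_multiplicity[of m n])
         (auto simp: left_diff_distrib sum_subtractf sum.inter_filter intro!: sum.cong)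
    have d_nonneg: "d m \<ge> 0" if "m \<in> {1..n}" for m
      unfolding d[OF that]
    proof (rule sum_nonneg)
      fix p assume "p \<in> primes_le n"
      then have p: "prime p" "p \<ge> 1" using primes_le_ge_2[of p n] by (auto simp: primes_le_iff)
      have "multiplicity p m \<ge> 1" if "p dvd m"
        using that p \<open>m \<in> {1..n}\<close> by (auto simp: Suc_le_eq prime_multiplicity_gt_zero_iff)
      then show "(real (multiplicity p m) - (if p dvd m then 1 else 0)) * ln (real p) \<ge> 0"
        using p by auto
    qed
    have count: "(\<Sum>m\<in>{1..n}. real (multiplicity p m) - (if p dvd m then 1 else 0))
        = real (\<Sum>m\<in>{1..n div p}. multiplicity p m)" if "prime p" for p
    proof -
      have "(\<Sum>m\<in>{1..n}. if p dvd m then 1 else 0 :: real) = real (n div p)"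
        using card_multiples[of p n] that
        by (subst sum.inter_filter [symmetric]) (auto simp: prime_gt_0_nat)
      then show ?thesis
        using sum_multiplicity_rec[OF that, of n] by (simp add: sum_subtractf flip: of_nat_sum)
    qed
    have total: "(\<Sum>m\<in>{1..n}. d m) = (\<Sum>p\<in>primes_le n. real (\<Sum>m\<in>{1..n div p}. multiplicity p m) * ln (real p))"
    proof -
      have "(\<Sum>m\<in>{1..n}. d m) = (\<Sum>m\<in>{1..n}. \<Sum>p\<in>primes_le n. (real (multiplicity p m) - (if p dvd m then 1 else 0)) * ln (real p))"
        by (rule sum.cong) (use d in auto)
      also have "\<dots> = (\<Sum>p\<in>primes_le n. (\<Sum>m\<in>{1..n}. real (multiplicity p m) - (if p dvd m then 1 else 0)) * ln (real p))"
        by (subst sum.swap) (simp add: sum_distrib_right)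
      also have "\<dots> = (\<Sum>p\<in>primes_le n. real (\<Sum>m\<in>{1..n div p}. multiplicity p m) * ln (real p))"
        by (rule sum.cong) (use count primes_le_iff in auto)
      finally show ?thesis .
    qed
    also have "\<dots> \<le> (\<Sum>p\<in>primes_le n. real n * (ln (real p) / (real p * (real p - 1))))"
    proof (rule sum_mono)
      fix p assume "p \<in> primes_le n"
      then have p: "prime p" "real p \<ge> 2" using primes_le_ge_2[of p n] by (auto simp: primes_le_iff)
      have "real (\<Sum>m\<in>{1..n div p}. multiplicity p m) \<le> real (n div p) / (real p - 1)"
        by (rule sum_multiplicity_le) fact
      also have "\<dots> \<le> (real n / real p) / (real p - 1)"
        by (intro divide_right_mono of_nat_div_le_of_nat) (use p in auto)
      finally have "real (\<Sum>m\<in>{1..n div p}. multiplicity p m) * ln (real p) \<le> (real n / real p) / (real p - 1) * ln (real p)"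
        by (rule mult_right_mono) (use p in auto)
      then show "real (\<Sum>m\<in>{1..n div p}. multiplicity p m) * ln (real p) \<le> real n * (ln (real p) / (real p * (real p - 1)))"
        by (simp add: algebra_simps)
    qed
    also have "\<dots> \<le> real n * C"
      unfolding sum_distrib_left [symmetric] by (intro mult_left_mono C) auto
    finally have up: "(\<Sum>m\<in>{1..n}. d m) \<le> C * real n" by (simp add: mult.commute)
    have sub: "\<bar>\<Sum>m\<in>A. d m\<bar> \<le> C * real n" if "A \<subseteq> {1..n}" for A
    proof -
      have "(\<Sum>m\<in>A. d m) \<ge> 0" using that d_nonneg by (intro sum_nonneg) auto
      moreover have "(\<Sum>m\<in>A. d m) \<le> (\<Sum>m\<in>{1..n}. d m)"
        using that d_nonneg by (intro sum_mono2) auto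
      ultimately show ?thesis using up by simp
    qed
    have "(\<Sum>m\<in>{1..n}. \<Sum>p\<in>{p\<in>primes_le n. p dvd m}. ln (real p)) = (\<Sum>p\<in>primes_le n. ln (real p) * real (n div p))"
    proof -
      have "(\<Sum>m\<in>{1..n}. \<Sum>p\<in>{p\<in>primes_le n. p dvd m}. ln (real p))
          = (\<Sum>p\<in>primes_le n. \<Sum>m\<in>{m\<in>{1..n}. p dvd m}. ln (real p))"
        by (rule sum.swap_restrict) auto
      also have "\<dots> = (\<Sum>p\<in>primes_le n. ln (real p) * real (n div p))"
        by (rule sum.cong)
           (simp_all only: sum_constant card_multiples primes_le_iff prime_gt_0_nat mult.commute)
      finally show ?thesis .
    qed
    then have "(\<Sum>m\<in>{1..n}. ln (real m)) - (\<Sum>p\<in>primes_le n. ln (real p) * real (n div p)) = (\<Sum>m\<in>{1..n}. d m)"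
      by (simp add: d_def sum_subtractf)
    with sub show "\<bar>(\<Sum>m\<in>{1..n}. ln (real m)) - (\<Sum>p\<in>primes_le n. ln (real p) * real (n div p))\<bar> \<le> C * real n \<and>
      (\<forall>A\<subseteq>{1..n}. \<bar>(\<Sum>m\<in>A. ln (real m) - (\<Sum>p\<in>{p\<in>primes_le n. p dvd m}. ln (real p)))\<bar> \<le> C * real n)"
      by (auto simp: d_def)
  qed
qed

lemma sum_ln_bounds:
  "(\<Sum>m\<in>{1..n}. ln (real m)) \<le> real n * ln (real n)"
  "(\<Sum>m\<in>{1..n}. ln (real m)) \<ge> real n * ln (real n) - real n"
proof -
  show "(\<Sum>m\<in>{1..n}. ln (real m)) \<le> real n * ln (real n)"
    using sum_bounded_above[of "{1..n}" "\<lambda>m. ln (real m)" "ln (real n)"] by simp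
  show "(\<Sum>m\<in>{1..n}. ln (real m)) \<ge> real n * ln (real n) - real n"
  proof (induction n)
    case (Suc n)
    show ?case
    proof (cases "n = 0")
      case False
      have "ln (real (Suc n) / real n) \<le> real (Suc n) / real n - 1"
        using False by (intro ln_le_minus_one) auto
      also have "\<dots> = 1 / real n" using False by (simp add: field_simps)
      finally have "real n * ln (real (Suc n)) - real n * ln (real n) \<le> 1"
        using False by (simp add: ln_div field_simps)
      with Suc show ?thesis by (simp add: algebra_simps)
    qed simp
  qed simp
qed

theorem mertens_first:
  "\<exists>C\<ge>0. \<forall>n>0. \<bar>(\<Sum>p\<in>primes_le n. ln (real p) / real p) - ln (real n)\<bar> \<le> C"
proof -
  obtain C where C: "\<And>n. \<bar>(\<Sum>m\<in>{1..n}. ln (real m)) - (\<Sum>p\<in>primes_le n. ln (real p) * real (n div p))\<bar> \<le> C * real n"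
    using sum_ln_prime_divisors by blast
  have "C \<ge> 0" using C[of 1] by linarith
  show ?thesis
  \<comment> \<open>\<open>4\<close> pays for replacing \<open>n div p\<close> by
    \<open>n / p\<close> through \<open>theta_le\<close>, and \<open>1\<close> for the error in
    \<open>ln (fact n)\<close>.\<close>
  proof (intro exI[of _ "C + 5"] conjI allI impI)
    fix n :: nat assume n: "n > 0"
    define S where "S = (\<Sum>p\<in>primes_le n. ln (real p) / real p)"
    define T where "T = (\<Sum>p\<in>primes_le n. ln (real p) * real (n div p))"
    have "T \<le> real n * S" unfolding S_def T_def sum_distrib_left
    proof (rule sum_mono)
      fix p assume "p \<in> primes_le n"
      then have "p \<ge> 1" using primes_le_ge_2[of p n] by auto
      then have "ln (real p) * real (n div p) \<le> ln (real p) * (real n / real p)"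
        by (intro mult_left_mono of_nat_div_le_of_nat) auto
      then show "ln (real p) * real (n div p) \<le> real n * (ln (real p) / real p)"
        by (simp add: mult.commute)
    qed
    moreover have "real n * S - T \<le> theta n"
      unfolding S_def T_def theta_def sum_distrib_left sum_subtractf [symmetric]
    proof (rule sum_mono)
      fix p assume "p \<in> primes_le n"
      then have p: "p \<ge> 1" using primes_le_ge_2[of p n] by auto
      have "real n / real p \<le> real (n div p) + 1"
        using of_nat_le_div_plus_1[of p n] p by simp
      then have "ln (real p) * (real n / real p) \<le> ln (real p) * (real (n div p) + 1)"
        using p by (intro mult_left_mono) auto
      then show "real n * (ln (real p) / real p) - ln (real p) * real (n div p) \<le> ln (real p)"
        by (simp add: algebra_simps)
    qed
    ultimately have "\<bar>real n * S - real n * ln (real n)\<bar> \<le> (C + 5) * real n"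
      using theta_le[of n] C[of n] sum_ln_bounds[of n] unfolding T_def [symmetric]
      by (auto simp: algebra_simps abs_le_iff)
    then have "real n * \<bar>S - ln (real n)\<bar> \<le> real n * (C + 5)"
      by (subst (asm) right_diff_distrib [symmetric]) (simp add: abs_mult mult.commute)
    then show "\<bar>S - ln (real n)\<bar> \<le> C + 5" using n by simp
  qed (use \<open>C \<ge> 0\<close> in auto)
qed

section \<open>Mertens' third theorem\<close>

lemma inverse_one_minus_eq: "y < 1 \<Longrightarrow> inverse (1 - y) - 1 = y + y * y / (1 - y)" for y :: real
  by (simp add: field_simps)

text \<open>The case \<open>t = 1\<close> is the Mertens factor and
  \<open>t = p powr - \<sigma>\<close> the Euler factor of zeta at \<open>1 + \<sigma>\<close>. The
  error term does not depend on \<open>t\<close>, which gives uniformity as \<sigma> tends to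
  0.\<close>

lemma one_minus_prime_bounds:
  fixes p t :: real assumes "p \<ge> 2" "0 \<le> t" "t \<le> 1"
  shows "t / p \<le> - ln (1 - t / p)" "- ln (1 - t / p) \<le> t / p + 1 / (p * (p - 1))"
proof -
  have y: "0 \<le> t / p" "t / p \<le> 1 / p" "1 / p \<le> 1 / 2" "t / p < 1"
    using assms by (auto simp: field_simps)
  show "t / p \<le> - ln (1 - t / p)"
    using ln_le_minus_one[of "1 - t / p"] y by simp
  have "- ln (1 - t / p) = ln (inverse (1 - t / p))"
    using y by (simp add: ln_inverse)
  also have "\<dots> \<le> inverse (1 - t / p) - 1" using y by (intro ln_le_minus_one) auto
  also have "\<dots> = t / p + (t / p) * (t / p) / (1 - t / p)"
    using y by (intro inverse_one_minus_eq)
  also have "(t / p) * (t / p) / (1 - t / p) \<le> (1 / p) * (1 / p) / (1 - 1 / p)"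
    using y assms by (intro frac_le mult_mono diff_left_mono) simp_all
  also have "(1 / p) * (1 / p) / (1 - 1 / p) = 1 / (p * (p - 1))"
    using assms by (simp add: field_simps)
  finally show "- ln (1 - t / p) \<le> t / p + 1 / (p * (p - 1))" by simp
qed

section \<open>Mertens' product along powers of two, split into dyadic bins\<close>

definition mertens_sum :: "nat \<Rightarrow> real" where
  "mertens_sum K = (\<Sum>p\<in>primes_le (2 ^ K). - ln (1 - 1 / real p))"

definition prime_bin :: "nat \<Rightarrow> nat set" where
  "prime_bin k = primes_le (2 ^ Suc k) - primes_le (2 ^ k)"

lemma finite_prime_bin [simp]: "finite (prime_bin k)"
  by (simp add: prime_bin_def)

lemma prime_bin_iff: "p \<in> prime_bin k \<longleftrightarrow> prime p \<and> 2 ^ k < p \<and> p \<le> 2 ^ Suc k"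
  unfolding prime_bin_def by (auto simp: primes_le_iff)

lemma prime_binD:
  assumes "p \<in> prime_bin k"
  shows "real p \<ge> 2" "2 ^ k + 1 \<le> real p" "real p \<le> 2 ^ Suc k"
proof -
  from assms have p: "prime p" "2 ^ k + 1 \<le> p" "p \<le> 2 ^ Suc k"
    by (auto simp: prime_bin_iff)
  show "real p \<ge> 2" using prime_ge_2_nat[OF p(1)] by simp
  have "real (2 ^ k + 1) \<le> real p" using p(2) of_nat_le_iff by blast
  then show "2 ^ k + 1 \<le> real p" by simp
  have "real p \<le> real (2 ^ Suc k)" using p(3) of_nat_le_iff by blast
  then show "real p \<le> 2 ^ Suc k" by simp
qed

lemma sum_prime_bins:
  fixes f :: "nat \<Rightarrow> real"
  shows "(\<Sum>k<K. \<Sum>p\<in>prime_bin k. f p) = (\<Sum>p\<in>primes_le (2 ^ K). f p)"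
proof (induction K)
  case 0
  show ?case using primes_le_1[of 1] by simp
next
  case (Suc K)
  have "primes_le (2 ^ K) \<subseteq> primes_le (2 ^ Suc K)" by (rule primes_le_mono) simp
  then have "(\<Sum>p\<in>prime_bin K. f p) = (\<Sum>p\<in>primes_le (2 ^ Suc K). f p) - (\<Sum>p\<in>primes_le (2 ^ K). f p)"
    unfolding prime_bin_def by (intro sum_diff) auto
  with Suc show ?case by simp
qed

text \<open>A bin has at most \<open>2 ^ k\<close> elements. Excluding its left endpoint makes
  \<open>p - 1\<close>, and not only \<open>p\<close>, at least \<open>2 ^ k\<close>.\<close>

lemma prime_bin_square_sum: "(\<Sum>p\<in>prime_bin k. 1 / (real p * (real p - 1))) \<le> (1 / 2) ^ k"
proof -
  have "(\<Sum>p\<in>prime_bin k. 1 / (real p * (real p - 1))) \<le> (\<Sum>p\<in>prime_bin k. 1 / (2 ^ k * 2 ^ k))"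
  proof (rule sum_mono)
    fix p assume p: "p \<in> prime_bin k"
    have "(2::real) ^ k * 2 ^ k \<le> real p * (real p - 1)"
      using prime_binD(2)[OF p] by (intro mult_mono) (linarith | simp)+
    then show "1 / (real p * (real p - 1)) \<le> 1 / (2 ^ k * 2 ^ k)"
      by (intro divide_left_mono mult_pos_pos) (use prime_binD(1)[OF p] in auto)
  qed
  also have "\<dots> = real (card (prime_bin k)) * (1 / (2 ^ k * 2 ^ k))" by simp
  also have "\<dots> \<le> 2 ^ k * (1 / (2 ^ k * 2 ^ k))"
  proof (rule mult_right_mono)
    have "card (prime_bin k) \<le> card {2 ^ k<..2 ^ Suc k :: nat}"
      by (intro card_mono) (auto simp: prime_bin_iff)
    then have "card (prime_bin k) \<le> 2 ^ k" by simp
    then have "real (card (prime_bin k)) \<le> real (2 ^ k)" using of_nat_le_iff by blast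
    then show "real (card (prime_bin k)) \<le> 2 ^ k" by simp
  qed auto
  finally show ?thesis by (simp add: power_one_over)
qed

definition bin_weight :: "nat \<Rightarrow> real" where
  "bin_weight k = (\<Sum>p\<in>prime_bin k. - ln (1 - 1 / real p))"

lemma mertens_sum_eq: "mertens_sum K = (\<Sum>k<K. bin_weight k)"
  unfolding mertens_sum_def bin_weight_def by (rule sum_prime_bins [symmetric])

text \<open>Summation by parts: the series converges in general only conditionally.\<close>

lemma summable_telescope_over_index:
  fixes R :: "nat \<Rightarrow> real"
  assumes R: "\<And>k. \<bar>R k\<bar> \<le> C"
  shows "summable (\<lambda>k. (R (Suc k) - R k) / real (Suc k))"
proof -
  have parts: "(\<Sum>k<K. (R (Suc k) - R k) / real (Suc k))
      = R K / real (Suc K) - R 0 + (\<Sum>k<K. R (Suc k) * (1 / real (Suc k) - 1 / real (Suc (Suc k))))" for K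
    by (induction K) (simp_all add: algebra_simps diff_divide_distrib)
  have "C \<ge> 0" using R[of 0] by linarith
  have "summable (\<lambda>k. 1 / real (Suc k) ^ 2)"
    using inverse_squares_sums by (simp add: sums_iff add.commute)
  then have "summable (\<lambda>k. C * (1 / real (Suc k) ^ 2))" by (rule summable_mult)
  then have "summable (\<lambda>k. R (Suc k) * (1 / real (Suc k) - 1 / real (Suc (Suc k))))"
  proof (rule summable_comparison_test' [where N = 0])
    fix k :: nat
    have "1 / real (Suc k) - 1 / real (Suc (Suc k)) = 1 / (real (Suc k) * real (Suc (Suc k)))"
      by (simp add: field_simps)
    moreover have "\<dots> \<le> 1 / real (Suc k) ^ 2"
      unfolding power2_eq_square by (intro divide_left_mono mult_left_mono) auto
    ultimately have "\<bar>1 / real (Suc k) - 1 / real (Suc (Suc k))\<bar> \<le> 1 / real (Suc k) ^ 2" by simp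
    then show "norm (R (Suc k) * (1 / real (Suc k) - 1 / real (Suc (Suc k)))) \<le> C * (1 / real (Suc k) ^ 2)"
      unfolding real_norm_def abs_mult using R \<open>C \<ge> 0\<close> by (intro mult_mono) auto
  qed
  then obtain s where s: "(\<lambda>K. \<Sum>k<K. R (Suc k) * (1 / real (Suc k) - 1 / real (Suc (Suc k)))) \<longlonglongrightarrow> s"
    unfolding summable_def sums_def by blast
  have "(\<lambda>K. R K / real (Suc K)) \<longlonglongrightarrow> 0"
  proof (rule Lim_null_comparison)
    show "\<forall>\<^sub>F K in sequentially. norm (R K / real (Suc K)) \<le> C / real (Suc K)"
      using R by (intro always_eventually allI) (simp add: divide_right_mono)
    show "(\<lambda>K. C / real (Suc K)) \<longlonglongrightarrow> 0" by real_asymp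
  qed
  then have "(\<lambda>K. \<Sum>k<K. (R (Suc k) - R k) / real (Suc k)) \<longlonglongrightarrow> 0 - R 0 + s"
    unfolding parts by (intro tendsto_intros s)
  then show ?thesis unfolding summable_def sums_def by blast
qed

text \<open>In units of \<open>ln 2\<close>, Mertens' first theorem says that the
  \<open>ln p / p\<close> of bin \<open>k\<close> add up to \<open>1 + R (Suc k) - R k\<close> with
  \<open>R\<close> bounded. Division by \<open>Suc k\<close> nearly turns \<open>ln p / p\<close>
  into \<open>1 / p\<close>, since \<open>ln p\<close> is about \<open>Suc k * ln 2\<close>. The
  differences of \<open>R\<close> are handled by summation by parts, and the defect \<open>e\<close>
  is absolutely summable.\<close>

lemma bin_weight_estimates:
  shows "summable (\<lambda>k. bin_weight k - 1 / real (Suc k))"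
    and "\<exists>C. \<forall>k. bin_weight k \<le> C / real (Suc k)"
proof -
  obtain C where "C \<ge> 0" and C: "\<And>n. n > 0 \<Longrightarrow> \<bar>(\<Sum>p\<in>primes_le n. ln (real p) / real p) - ln (real n)\<bar> \<le> C"
    using mertens_first by blast
  have ln2: "ln (2::real) > 0" by simp
  define R where "R K = (\<Sum>p\<in>primes_le (2 ^ K). ln (real p) / real p) / ln 2 - real K" for K
  define b where "b k = (\<Sum>p\<in>prime_bin k. ln (real p) / real p) / ln 2" for k
  define e where "e k = bin_weight k - b k / real (Suc k)" for k
  define C' where "C' = C / ln 2"
  have R: "\<bar>R K\<bar> \<le> C'" for K
  proof -
    have "R K = ((\<Sum>p\<in>primes_le (2 ^ K). ln (real p) / real p) - ln (real (2 ^ K))) / ln 2"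
      using ln2 by (simp add: R_def ln_realpow diff_divide_distrib)
    also have "\<bar>\<dots>\<bar> \<le> C / ln 2"
      using C[of "2 ^ K"] ln2 by (simp add: abs_divide divide_right_mono)
    finally show ?thesis by (simp add: C'_def)
  qed
  have b: "b k = 1 + R (Suc k) - R k" for k
    using sum_prime_bins[of "\<lambda>p. ln (real p) / real p" "Suc k"] sum_prime_bins[of "\<lambda>p. ln (real p) / real p" k]
    by (simp add: b_def R_def diff_divide_distrib [symmetric])
  have b_le: "b k \<le> 1 + 2 * C'" for k using R[of k] R[of "Suc k"] b[of k] by linarith
  have b_nonneg: "b k \<ge> 0" for k
    unfolding b_def using ln2 by (intro divide_nonneg_pos sum_nonneg) (auto dest!: prime_binD(1))
  have lb: "real k * ln 2 \<le> ln (real p)" "ln (real p) \<le> real (Suc k) * ln 2" if "p \<in> prime_bin k" for p k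
  proof -
    have "2 ^ k \<le> real p" using prime_binD(2)[OF that] by linarith
    with prime_binD[OF that] have "ln (2 ^ k) \<le> ln (real p)" "ln (real p) \<le> ln (2 ^ Suc k)"
      by (simp_all del: power_Suc)
    then show "real k * ln 2 \<le> ln (real p)" "ln (real p) \<le> real (Suc k) * ln 2"
      by (simp_all add: ln_realpow del: power_Suc)
  qed
  \<comment> \<open>In bin 0 the lower bound \<open>k * ln 2\<close> is void; there
    \<open>p \<ge> 2\<close> takes over.\<close>
  have lb2: "real (Suc k) * ln 2 \<le> 2 * ln (real p)" if "p \<in> prime_bin k" for p k
  proof (cases "k = 0")
    case True
    have "ln 2 \<le> ln (real p)" using prime_binD(1)[OF that] by simp
    with ln2 have "ln 2 \<le> 2 * ln (real p)" by linarith
    with True show ?thesis by simp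
  next
    case False
    then have "real (Suc k) * ln 2 \<le> (2 * real k) * ln 2" using ln2 by (intro mult_right_mono) auto
    also have "\<dots> = 2 * (real k * ln 2)" by simp
    also have "\<dots> \<le> 2 * ln (real p)" using lb(1)[OF that] by (rule mult_left_mono) simp
    finally show ?thesis .
  qed
  have e_nonneg: "e k \<ge> 0" for k
  proof -
    have "b k / real (Suc k) = (\<Sum>p\<in>prime_bin k. ln (real p) / real p / ln 2 / real (Suc k))"
      by (simp add: b_def sum_divide_distrib)
    also have "\<dots> \<le> bin_weight k"
      unfolding bin_weight_def
    proof (rule sum_mono)
      fix p assume p: "p \<in> prime_bin k"
      have "ln (real p) / real p / ln 2 / real (Suc k) = (ln (real p) / (real (Suc k) * ln 2)) / real p"
        by (simp add: field_simps)
      also have "\<dots> \<le> 1 / real p"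
        using lb(2)[OF p] ln2 by (intro divide_right_mono) (auto simp: divide_le_eq)
      also have "\<dots> \<le> - ln (1 - 1 / real p)"
        using one_minus_prime_bounds(1)[of p 1] prime_binD(1)[OF p] by simp
      finally show "ln (real p) / real p / ln 2 / real (Suc k) \<le> - ln (1 - 1 / real p)" .
    qed
    finally show ?thesis by (simp add: e_def)
  qed
  have e_le: "e k \<le> 2 * (1 + 2 * C') * (1 / real (Suc k) ^ 2) + (1/2) ^ k" for k
  proof -
    have "bin_weight k \<le> (\<Sum>p\<in>prime_bin k. ln (real p) / real p / ln 2 / real (Suc k)
        + 2 * (ln (real p) / real p / ln 2 / real (Suc k) ^ 2) + 1 / (real p * (real p - 1)))"
      unfolding bin_weight_def
    proof (rule sum_mono)
      fix p assume p: "p \<in> prime_bin k"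
      have p2: "real p \<ge> 2" using prime_binD(1)[OF p] .
      define x where "x = ln (real p) / ln 2"
      define K where "K = real (Suc k)"
      have x: "real k \<le> x" "K \<le> 2 * x"
        using lb(1)[OF p] lb2[OF p] ln2 by (auto simp: x_def K_def field_simps)
      have "K > 0" "K = real k + 1" by (auto simp: K_def)
      \<comment> \<open>The leftover \<open>1 / K\<close> is itself made proportional to
        \<open>x\<close>, so that summing over the bin gives back multiples of
        \<open>b k\<close>.\<close>
      have "1 \<le> x / K + 1 / K" using x \<open>K > 0\<close> \<open>K = real k + 1\<close> by (simp add: field_simps)
      also have "1 / K \<le> 2 * (x / K ^ 2)" using x \<open>K > 0\<close> by (simp add: field_simps power2_eq_square)
      finally have "1 / real p \<le> (x / K + 2 * (x / K ^ 2)) / real p"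
        using p2 by (intro divide_right_mono) auto
      moreover have "- ln (1 - 1 / real p) \<le> 1 / real p + 1 / (real p * (real p - 1))"
        using one_minus_prime_bounds(2)[of p 1] p2 by simp
      ultimately show "- ln (1 - 1 / real p) \<le> ln (real p) / real p / ln 2 / real (Suc k)
        + 2 * (ln (real p) / real p / ln 2 / real (Suc k) ^ 2) + 1 / (real p * (real p - 1))"
        by (simp add: x_def K_def add_divide_distrib mult.commute mult.left_commute)
    qed
    also have "\<dots> = b k / real (Suc k) + 2 * (b k / real (Suc k) ^ 2) + (\<Sum>p\<in>prime_bin k. 1 / (real p * (real p - 1)))"
      by (simp add: sum.distrib b_def sum_divide_distrib sum_distrib_left)
    finally have "e k \<le> 2 * (b k / real (Suc k) ^ 2) + (1/2) ^ k"
      using prime_bin_square_sum[of k] by (simp add: e_def)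
    also have "b k / real (Suc k) ^ 2 \<le> (1 + 2 * C') / real (Suc k) ^ 2"
      using b_le by (intro divide_right_mono) auto
    finally show ?thesis by simp
  qed
  have sq: "summable (\<lambda>k. 1 / real (Suc k) ^ 2)"
    using inverse_squares_sums by (simp add: sums_iff add.commute)
  have "summable (\<lambda>k. 2 * (1 + 2 * C') * (1 / real (Suc k) ^ 2) + (1/2) ^ k)"
    by (intro summable_add summable_mult sq) (simp add: summable_geometric)
  then have "summable e"
    by (rule summable_comparison_test' [where N = 0]) (use e_nonneg e_le in auto)
  moreover have "summable (\<lambda>k. (R (Suc k) - R k) / real (Suc k))"
    using R by (rule summable_telescope_over_index)
  ultimately have "summable (\<lambda>k. (R (Suc k) - R k) / real (Suc k) + e k)"
    using summable_add by blast
  also have "(\<lambda>k. (R (Suc k) - R k) / real (Suc k) + e k) = (\<lambda>k. bin_weight k - 1 / real (Suc k))"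
    by (auto simp: e_def b diff_divide_distrib add_divide_distrib)
  finally show "summable (\<lambda>k. bin_weight k - 1 / real (Suc k))" .
  show "\<exists>C. \<forall>k. bin_weight k \<le> C / real (Suc k)"
  proof (intro exI allI)
    fix k
    have C'0: "C' \<ge> 0" using \<open>C \<ge> 0\<close> ln2 by (simp add: C'_def)
    have "bin_weight k = b k / real (Suc k) + e k" by (simp add: e_def)
    also have "\<dots> \<le> (1 + 2 * C') / real (Suc k) + (2 * (1 + 2 * C') * (1 / real (Suc k) ^ 2) + (1/2) ^ k)"
      using b_le e_le by (intro add_mono divide_right_mono) auto
    also have "2 * (1 + 2 * C') * (1 / real (Suc k) ^ 2) \<le> 2 * (1 + 2 * C') * (1 / real (Suc k))"
      using C'0 by (intro mult_left_mono divide_left_mono) (auto simp: power2_eq_square)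
    also have "(1/2::real) ^ k \<le> 1 / real (Suc k)"
    proof -
      have "real (Suc k) \<le> real (2 ^ k)" using less_exp[of k] by (simp only: of_nat_le_iff Suc_le_eq)
      then show ?thesis unfolding power_one_over by (intro divide_left_mono) auto
    qed
    finally show "bin_weight k \<le> (3 * (1 + 2 * C') + 1) / real (Suc k)"
      by (simp add: add_divide_distrib)
  qed
qed

section \<open>Abel's limit theorem\<close>

text \<open>Summation by parts writes the power series as \<open>c\<close> plus
  \<open>(1 - z)\<close> times the power series of \<open>S (Suc k) - c\<close>. The factor
  \<open>1 - z\<close> kills any finite number of terms, and in the tail it cancels the geometric
  sum \<open>1 / (1 - z)\<close>.\<close>

lemma Abel_limit_at_left_1:
  fixes a :: "nat \<Rightarrow> real"
  assumes "a sums c"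
  shows "((\<lambda>z. \<Sum>k. a k * z ^ k) \<longlongrightarrow> c) (at_left 1)"
    and "\<And>z. 0 \<le> z \<Longrightarrow> z < 1 \<Longrightarrow> summable (\<lambda>k. a k * z ^ k)"
proof -
  define S where "S k = (\<Sum>i<k. a i)" for k
  have S: "S \<longlonglongrightarrow> c" using assms by (simp add: sums_def S_def[abs_def])
  then obtain M where M: "\<And>k. \<bar>S k - c\<bar> \<le> M"
    using tendsto_diff[OF S tendsto_const[of c], THEN convergentI, THEN convergent_imp_Bseq]
    unfolding Bseq_def by auto
  have M0: "M \<ge> 0" using M[of 0] by linarith
  have geo: "summable (\<lambda>k. z ^ k)" if "0 \<le> z" "z < 1" for z :: real
    using that by (intro summable_geometric) auto
  have sumS: "summable (\<lambda>k. (S (m + k) - c) * z ^ k)" if "0 \<le> z" "z < 1" for z m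
  proof (rule summable_comparison_test' [where N = 0])
    show "summable (\<lambda>k. M * z ^ k)" using geo[OF that] by (rule summable_mult)
    show "norm ((S (m + k) - c) * z ^ k) \<le> M * z ^ k" for k
      using M[of "m + k"] that by (auto simp: abs_mult intro!: mult_right_mono)
  qed
  have a_eq: "a k * z ^ k = (S (Suc k) - c) * z ^ k - (S k - c) * z ^ k" for k z
    by (simp add: S_def algebra_simps)
  show summ: "summable (\<lambda>k. a k * z ^ k)" if "0 \<le> z" "z < 1" for z
    unfolding a_eq using sumS[OF that, of 1] sumS[OF that, of 0] by (intro summable_diff) auto
  have eq: "(\<Sum>k. a k * z ^ k) = c + (1 - z) * (\<Sum>k. (S (Suc k) - c) * z ^ k)" if "0 \<le> z" "z < 1" for z
  proof -
    have "(\<Sum>k. a k * z ^ k) = (\<Sum>k. (S (Suc k) - c) * z ^ k) - (\<Sum>k. (S k - c) * z ^ k)"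
      unfolding a_eq using sumS[OF that, of 1] sumS[OF that, of 0] by (intro suminf_diff [symmetric]) auto
    also have "(\<Sum>k. (S k - c) * z ^ k) = (\<Sum>k. (S (Suc k) - c) * z ^ Suc k) + (S 0 - c)"
      using suminf_split_head[OF sumS[OF that, of 0]] by simp
    also have "(\<Sum>k. (S (Suc k) - c) * z ^ Suc k) = z * (\<Sum>k. (S (Suc k) - c) * z ^ k)"
      using sumS[OF that, of 1] by (subst suminf_mult [symmetric]) (auto simp: mult_ac)
    finally show ?thesis by (simp add: S_def algebra_simps)
  qed
  have "((\<lambda>z. (1 - z) * (\<Sum>k. (S (Suc k) - c) * z ^ k)) \<longlongrightarrow> 0) (at_left 1)"
  proof (rule tendstoI)
    fix \<epsilon> :: real assume "\<epsilon> > 0"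
    then obtain N where N: "\<And>k. k \<ge> N \<Longrightarrow> \<bar>S (Suc k) - c\<bar> \<le> \<epsilon> / 2"
      using LIMSEQ_D[OF S, of "\<epsilon> / 2"] by (metis half_gt_zero le_SucI less_imp_le real_norm_def)
    have bound: "\<bar>(1 - z) * (\<Sum>k. (S (Suc k) - c) * z ^ k)\<bar> \<le> (1 - z) * (M * real N) + \<epsilon> / 2"
      if z: "0 \<le> z" "z < 1" for z
    proof -
      \<comment> \<open>A dominating series with an explicit sum: the crude bound \<open>M\<close>
        for the first \<open>N\<close> terms, the small geometric series for the tail.\<close>
      define f where "f k = (if k < N then M else 0) + \<epsilon> / 2 * z ^ k" for k
      have fN: "(\<lambda>k. if k < N then M else 0) sums (M * real N)"
        using sums_If_finite_set[of "{..<N}" "\<lambda>_. M"] by (simp add: mult.commute)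
      have f: "f sums (M * real N + \<epsilon> / 2 * (1 / (1 - z)))"
        unfolding f_def using z by (intro sums_add fN sums_mult geometric_sums) auto
      have le: "\<bar>(S (Suc k) - c) * z ^ k\<bar> \<le> f k" for k
      proof (cases "k < N")
        case True
        have "\<bar>(S (Suc k) - c) * z ^ k\<bar> \<le> M * 1"
          unfolding abs_mult using z M M0 by (intro mult_mono) (auto simp: power_le_one)
        also have "\<dots> \<le> f k" using True z \<open>\<epsilon> > 0\<close> by (simp add: f_def)
        finally show ?thesis .
      next
        case False
        then show ?thesis using mult_right_mono[OF N[of k], of "z ^ k"] z by (simp add: f_def abs_mult)
      qed
      have "summable (\<lambda>k. norm ((S (Suc k) - c) * z ^ k))"
        by (rule summable_comparison_test' [OF sums_summable[OF f], where N = 0]) (use le in auto)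
      then have "norm (\<Sum>k. (S (Suc k) - c) * z ^ k) \<le> (\<Sum>k. norm ((S (Suc k) - c) * z ^ k))"
        by (rule summable_norm)
      also have "\<dots> \<le> (\<Sum>k. f k)"
        using le sums_summable[OF f] \<open>summable (\<lambda>k. norm ((S (Suc k) - c) * z ^ k))\<close>
        by (intro suminf_le) auto
      also have "\<dots> = M * real N + \<epsilon> / 2 * (1 / (1 - z))" using f by (simp add: sums_iff)
      finally have "(1 - z) * \<bar>\<Sum>k. (S (Suc k) - c) * z ^ k\<bar> \<le> (1 - z) * (M * real N + \<epsilon> / 2 * (1 / (1 - z)))"
        using z by (intro mult_left_mono) auto
      also have "\<dots> = (1 - z) * (M * real N) + \<epsilon> / 2" using z by (simp add: field_simps)
      finally show ?thesis using z by (simp add: abs_mult)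
    qed
    have "((\<lambda>z. (1 - z) * (M * real N) + \<epsilon> / 2) \<longlongrightarrow> (1 - 1) * (M * real N) + \<epsilon> / 2) (at_left 1)"
      by (intro tendsto_intros)
    then have "\<forall>\<^sub>F z in at_left 1. (1 - z) * (M * real N) + \<epsilon> / 2 < \<epsilon>"
      by (rule order_tendstoD) (use \<open>\<epsilon> > 0\<close> in simp)
    moreover have "\<forall>\<^sub>F z in at_left 1. 0 \<le> z \<and> z < (1::real)"
      using eventually_at_left_real[of 0 1] by (auto elim!: eventually_mono)
    ultimately show "\<forall>\<^sub>F z in at_left 1. dist ((1 - z) * (\<Sum>k. (S (Suc k) - c) * z ^ k)) 0 < \<epsilon>"
      by eventually_elim (use bound in \<open>force simp: dist_real_def\<close>)
  qed
  then have "((\<lambda>z. c + (1 - z) * (\<Sum>k. (S (Suc k) - c) * z ^ k)) \<longlongrightarrow> c + 0) (at_left 1)"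
    by (intro tendsto_intros)
  moreover have "\<forall>\<^sub>F z in at_left 1. 0 \<le> z \<and> z < (1::real)"
    using eventually_at_left_real[of 0 1] by (auto elim!: eventually_mono)
  then have "\<forall>\<^sub>F z in at_left 1. c + (1 - z) * (\<Sum>k. (S (Suc k) - c) * z ^ k) = (\<Sum>k. a k * z ^ k)"
    by eventually_elim (simp add: eq)
  ultimately show "((\<lambda>z. \<Sum>k. a k * z ^ k) \<longlongrightarrow> c) (at_left 1)"
    by (simp add: tendsto_cong)
qed

section \<open>The Euler product as a sieve, and zeta to the right of 1\<close>

definition coprime_to :: "nat set \<Rightarrow> nat set" where
  "coprime_to P = {m. \<forall>p\<in>P. \<not> p dvd m}"

text \<open>One sieving step. Multiplication by \<open>p\<close> does not affect divisibility by the
  other primes, so the multiples of \<open>p\<close> that survive \<open>P\<close> form a scaled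
  copy of the survivors. Both the Euler product and Rankin's sieve are inductions over this
  step.\<close>

lemma coprime_to_insert:
  assumes "prime p" "p \<notin> P" "\<And>q. q \<in> P \<Longrightarrow> prime q"
  shows "coprime_to (insert p P) = coprime_to P - (\<lambda>m. p * m) ` coprime_to P"
    and "(\<lambda>m. p * m) ` coprime_to P \<subseteq> coprime_to P"
proof -
  have *: "q dvd p * m \<longleftrightarrow> q dvd m" if "q \<in> P" for q m
    using assms that by (metis prime_dvd_mult_iff primes_dvd_imp_eq)
  show sub: "(\<lambda>m. p * m) ` coprime_to P \<subseteq> coprime_to P"
    using * by (auto simp: coprime_to_def)
  show "coprime_to (insert p P) = coprime_to P - (\<lambda>m. p * m) ` coprime_to P"
  proof (intro equalityI subsetI)
    fix m assume "m \<in> coprime_to (insert p P)"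
    then show "m \<in> coprime_to P - (\<lambda>m. p * m) ` coprime_to P"
      by (auto simp: coprime_to_def)
  next
    fix m assume m: "m \<in> coprime_to P - (\<lambda>m. p * m) ` coprime_to P"
    have "\<not> p dvd m"
    proof
      assume "p dvd m"
      then obtain k where "m = p * k" unfolding dvd_def by blast
      with m * show False by (auto simp: coprime_to_def)
    qed
    with m show "m \<in> coprime_to (insert p P)" by (auto simp: coprime_to_def)
  qed
qed

text \<open>Removing the scaled copy multiplies the sum by \<open>1 - p powr - s\<close>. The index
  0 is harmless, since \<open>0 powr - s\<close> is 0.\<close>

lemma Euler_sieve_has_sum:
  fixes s Z :: real
  assumes Z: "((\<lambda>m. real m powr - s) has_sum Z) UNIV"
    and "finite P" "\<And>p. p \<in> P \<Longrightarrow> prime p"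
  shows "((\<lambda>m. real m powr - s) has_sum (Z * (\<Prod>p\<in>P. 1 - real p powr - s))) (coprime_to P)"
  using assms(2,3)
proof (induction P rule: finite_induct)
  case empty
  then show ?case using Z by (simp add: coprime_to_def)
next
  case (insert p P)
  let ?f = "\<lambda>m. real m powr - s"
  define W where "W = Z * (\<Prod>p\<in>P. 1 - real p powr - s)"
  have W: "(?f has_sum W) (coprime_to P)" using insert by (simp add: W_def)
  have "(?f has_sum (real p powr - s * W)) ((\<lambda>m. p * m) ` coprime_to P)"
  proof (subst has_sum_reindex)
    show "inj_on ((*) p) (coprime_to P)" using insert(4)[of p] by (auto simp: inj_on_def prime_gt_0_nat)
    have "((\<lambda>m. real p powr - s * ?f m) has_sum (real p powr - s * W)) (coprime_to P)"
      by (intro has_sum_cmult_right W)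
    then show "(?f \<circ> (*) p has_sum (real p powr - s * W)) (coprime_to P)"
      by (simp add: o_def powr_mult)
  qed
  then have "(?f has_sum (W - real p powr - s * W)) (coprime_to (insert p P))"
    using coprime_to_insert[of p P] insert W by (auto intro!: has_sum_Diff)
  then show ?case using insert by (simp add: W_def algebra_simps)
qed

text \<open>Gives \<open>\<sigma> * zeta (1 + \<sigma>) = 1 + O(\<sigma>)\<close>. By the mean value
  theorem the differences of \<open>m powr - \<sigma>\<close> lie between consecutive terms scaled
  by \<sigma>, and these differences telescope to 1.\<close>

lemma zeta_bounds:
  fixes \<sigma> :: real assumes "\<sigma> > 0"
  shows "\<exists>Z. (\<lambda>m. real m powr - (1 + \<sigma>)) sums Z \<and> 1 \<le> \<sigma> * Z \<and> \<sigma> * Z \<le> 1 + \<sigma>"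
proof -
  let ?f = "\<lambda>m. real m powr - (1 + \<sigma>)"
  have step: "\<sigma> * ?f (Suc m) \<le> real m powr - \<sigma> - real (Suc m) powr - \<sigma>"
    "real m powr - \<sigma> - real (Suc m) powr - \<sigma> \<le> \<sigma> * ?f m" if "m \<ge> 1" for m
  proof -
    have "\<exists>z>real m. z < real (Suc m) \<and> real (Suc m) powr - \<sigma> - real m powr - \<sigma>
        = (real (Suc m) - real m) * (- \<sigma> * z powr (- \<sigma> - 1))"
      using that by (intro MVT2) (auto intro!: derivative_eq_intros)
    then obtain z where z: "real m < z" "z < real (Suc m)"
      "real (Suc m) powr - \<sigma> - real m powr - \<sigma> = - \<sigma> * z powr (- \<sigma> - 1)" by auto
    have "z powr (- \<sigma> - 1) \<le> real m powr (- \<sigma> - 1)" "real (Suc m) powr (- \<sigma> - 1) \<le> z powr (- \<sigma> - 1)"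
      using z that assms by (auto intro!: powr_mono2')
    then have "\<sigma> * z powr (- \<sigma> - 1) \<le> \<sigma> * real m powr (- \<sigma> - 1)"
      "\<sigma> * real (Suc m) powr (- \<sigma> - 1) \<le> \<sigma> * z powr (- \<sigma> - 1)"
      using assms by auto
    moreover have e: "- \<sigma> - 1 = - (1 + \<sigma>)" by simp
    moreover have "real m powr - \<sigma> - real (Suc m) powr - \<sigma> = \<sigma> * z powr (- \<sigma> - 1)"
      using z(3) by simp
    ultimately show "\<sigma> * ?f (Suc m) \<le> real m powr - \<sigma> - real (Suc m) powr - \<sigma>"
      "real m powr - \<sigma> - real (Suc m) powr - \<sigma> \<le> \<sigma> * ?f m"
      by (simp_all only:)
  qed
  have "summable ?f" using assms by (subst summable_real_powr_iff) auto
  then obtain Z where Z: "?f sums Z" by (auto simp: summable_def)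
  have Z1: "(\<lambda>m. ?f (Suc m)) sums Z" using sums_Suc_iff[of ?f Z] Z by simp
  have Z2: "(\<lambda>m. ?f (Suc (Suc m))) sums (Z - 1)"
    using sums_Suc_iff[of "\<lambda>m. ?f (Suc m)" "Z - 1"] Z1 by simp
  have "(\<lambda>m. real (Suc m) powr - \<sigma>) \<longlonglongrightarrow> 0" using assms by real_asymp
  from telescope_sums'[OF this]
  have tel: "(\<lambda>m. real (Suc m) powr - \<sigma> - real (Suc (Suc m)) powr - \<sigma>) sums 1" by simp
  have "1 \<le> \<sigma> * Z"
    by (rule sums_le[OF _ tel sums_mult[OF Z1]]) (rule step(2), simp)
  moreover have "\<sigma> * (Z - 1) \<le> 1"
    by (rule sums_le[OF _ sums_mult[OF Z2] tel]) (rule step(1), simp)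
  ultimately show ?thesis using Z by (intro exI[of _ Z]) (auto simp: algebra_simps)
qed

text \<open>After sieving by the primes up to \<open>N\<close>, the integer 1 survives, and every
  other positive survivor exceeds \<open>N\<close>. The sifted sum is thus squeezed between 1 and 1
  plus a tail of a convergent series.\<close>

lemma Euler_product:
  fixes s Z :: real
  assumes Z: "(\<lambda>m. real m powr - s) sums Z" and "s > 0"
  shows "(\<lambda>N. Z * (\<Prod>p\<in>primes_le N. 1 - real p powr - s)) \<longlonglongrightarrow> 1"
proof -
  let ?f = "\<lambda>m. real m powr - s"
  have Zh: "(?f has_sum Z) UNIV" using Z by (rule sums_nonneg_imp_has_sum) simp
  have E: "(?f has_sum (Z * (\<Prod>p\<in>primes_le N. 1 - real p powr - s))) (coprime_to (primes_le N))" for N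
    by (rule Euler_sieve_has_sum[OF Zh]) (auto simp: primes_le_iff)
  have lower: "1 \<le> Z * (\<Prod>p\<in>primes_le N. 1 - real p powr - s)" for N
  proof (rule has_sum_mono2[OF _ E])
    show "(?f has_sum 1) {1}" by (simp add: has_sum_finite_iff)
    show "{1} \<subseteq> coprime_to (primes_le N)"
      by (auto simp: coprime_to_def primes_le_iff)
  qed auto
  have upper: "Z * (\<Prod>p\<in>primes_le N. 1 - real p powr - s) \<le> Z - (\<Sum>m<Suc N. ?f m) + 1" for N
  proof -
    have "(?f has_sum (\<Sum>m\<in>{2..N}. ?f m)) {2..N}" by (simp add: has_sum_finite)
    then have D: "(?f has_sum (Z - (\<Sum>m\<in>{2..N}. ?f m))) (UNIV - {2..N})"
      by (intro has_sum_Diff Zh) auto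
    have "Z * (\<Prod>p\<in>primes_le N. 1 - real p powr - s) \<le> Z - (\<Sum>m\<in>{2..N}. ?f m)"
    proof (rule has_sum_mono2[OF E D])
      show "coprime_to (primes_le N) \<subseteq> UNIV - {2..N}"
      proof
        fix m assume m: "m \<in> coprime_to (primes_le N)"
        have False if "2 \<le> m" "m \<le> N"
        proof -
          have "m \<noteq> 1" using that by simp
          then obtain p where "prime p" "p dvd m" using prime_factor_nat by blast
          moreover from this have "p \<le> m" using that by (intro dvd_imp_le) auto
          ultimately have "p \<in> primes_le N" using that by (simp add: primes_le_iff)
          with m \<open>p dvd m\<close> show False by (simp add: coprime_to_def)
        qed
        then show "m \<in> UNIV - {2..N}" by auto
      qed
    qed auto
    moreover have "(\<Sum>m<Suc N. ?f m) \<le> (\<Sum>m\<in>{2..N}. ?f m) + 1"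
    proof -
      have "(\<Sum>m<Suc N. ?f m) \<le> (\<Sum>m\<in>insert 0 (insert 1 {2..N}). ?f m)"
        by (rule sum_mono2) auto
      also have "\<dots> = (\<Sum>m\<in>{2..N}. ?f m) + 1" by simp
      finally show ?thesis .
    qed
    ultimately show ?thesis by linarith
  qed
  have "(\<lambda>N. Z - (\<Sum>m<Suc N. ?f m) + 1) \<longlonglongrightarrow> Z - Z + 1"
    using Z[unfolded sums_def, THEN LIMSEQ_Suc] by (intro tendsto_intros)
  then have "(\<lambda>N. Z - (\<Sum>m<Suc N. ?f m) + 1) \<longlonglongrightarrow> 1" by simp
  then show ?thesis
    by (rule tendsto_sandwich[OF _ _ tendsto_const, rotated 2]) (use lower upper in auto)
qed

section \<open>Abel means of the bin weights compared with log zeta\<close>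

definition bin_weight_at :: "real \<Rightarrow> nat \<Rightarrow> real" where
  "bin_weight_at \<sigma> k = (\<Sum>p\<in>prime_bin k. - ln (1 - real p powr - (1 + \<sigma>)))"

lemma bin_weight_at_sums:
  assumes "\<sigma> > 0" and Z: "(\<lambda>m. real m powr - (1 + \<sigma>)) sums Z" "Z > 0"
  shows "bin_weight_at \<sigma> sums ln Z"
proof -
  let ?P = "\<lambda>K. \<Prod>p\<in>primes_le (2 ^ K). 1 - real p powr - (1 + \<sigma>)"
  have pos: "0 < 1 - real p powr - (1 + \<sigma>)" if "p \<in> primes_le N" for p N
  proof -
    have "real p powr - (1 + \<sigma>) < real p powr 0"
      using primes_le_ge_2[OF that] assms by (intro powr_less_mono) auto
    then show ?thesis using primes_le_ge_2[OF that] by simp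
  qed
  have eq: "(\<Sum>k<K. bin_weight_at \<sigma> k) = ln Z - ln (Z * ?P K)" for K
  proof -
    have "?P K > 0" by (intro prod_pos pos)
    then have "ln (Z * ?P K) = ln Z + ln (?P K)" using Z by (intro ln_mult_pos)
    then have "ln Z - ln (Z * ?P K) = - ln (?P K)" by simp
    also have "\<dots> = (\<Sum>p\<in>primes_le (2 ^ K). - ln (1 - real p powr - (1 + \<sigma>)))"
      unfolding sum_negf using pos[of _ "2 ^ K"] by (subst ln_prod) (auto simp: less_imp_neq)
    also have "\<dots> = (\<Sum>k<K. bin_weight_at \<sigma> k)"
      unfolding bin_weight_at_def by (rule sum_prime_bins [symmetric])
    finally show ?thesis by simp
  qed
  have "filterlim (\<lambda>K. 2 ^ K :: nat) at_top sequentially"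
    by (rule filterlim_subseq) (auto simp: strict_mono_def)
  from filterlim_compose[OF Euler_product[OF Z(1)] this]
  have "(\<lambda>K. Z * ?P K) \<longlonglongrightarrow> 1" using assms by simp
  then have "(\<lambda>K. ln Z - ln (Z * ?P K)) \<longlonglongrightarrow> ln Z - ln 1"
    by (intro tendsto_intros) auto
  then show ?thesis unfolding sums_def eq by simp
qed

lemma ln_one_minus_sums:
  fixes z :: real assumes "0 \<le> z" "z < 1"
  shows "(\<lambda>k. z ^ Suc k / real (Suc k)) sums (- ln (1 - z))"
proof -
  have "ln (1 - z) = (\<Sum>n. (-1)^n * (1 / real (n + 1)) * ((1 - z) - 1)^(Suc n))"
    by (rule ln_series) (use assms in auto)
  also have "(\<lambda>n. (-1)^n * (1 / real (n + 1)) * ((1 - z) - 1)^(Suc n)) = (\<lambda>n. - (z ^ Suc n / real (Suc n)))"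
    by (rule ext) (simp add: power_minus[of z] flip: power_add mult_2)
  finally have "ln (1 - z) = (\<Sum>n. - (z ^ Suc n / real (Suc n)))" .
  moreover have summ: "summable (\<lambda>k. z ^ Suc k / real (Suc k))"
  proof (rule summable_comparison_test' [where N = 0])
    show "summable (\<lambda>k. z ^ k)" using assms by (intro summable_geometric) auto
    fix k :: nat
    have "z ^ Suc k / real (Suc k) \<le> z ^ Suc k / 1" using assms by (intro divide_left_mono) auto
    also have "\<dots> \<le> z ^ k" using assms by (simp add: mult_left_le_one_le)
    finally show "norm (z ^ Suc k / real (Suc k)) \<le> z ^ k" using assms by simp
  qed
  ultimately show ?thesis using suminf_minus[OF summ] by (simp add: sums_iff)
qed

text \<open>\<open>z ^ k\<close> is the smallest of the \<open>Suc k\<close> terms of a geometric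
  sum whose product with \<open>1 - z\<close> is at most 1. With
  \<open>z = 2 powr - \<sigma>\<close> this bounds the variation of \<open>p powr - \<sigma>\<close>
  within a bin, uniformly in \<sigma>.\<close>

lemma power_gap_le:
  fixes z :: real assumes "0 \<le> z" "z \<le> 1"
  shows "(1 - z) * z ^ k \<le> 1 / real (Suc k)"
proof -
  have "real (Suc k) * z ^ k = (\<Sum>i<Suc k. z ^ k)" by simp
  also have "\<dots> \<le> (\<Sum>i<Suc k. z ^ i)"
    using assms by (intro sum_mono power_decreasing) auto
  finally have "(1 - z) * (real (Suc k) * z ^ k) \<le> (1 - z) * (\<Sum>i<Suc k. z ^ i)"
    using assms by (intro mult_left_mono) auto
  also have "\<dots> = 1 - z ^ Suc k" by (rule one_diff_power_eq [symmetric])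
  also have "\<dots> \<le> 1" using assms by simp
  finally show ?thesis by (simp add: field_simps)
qed

text \<open>The bound is summable in \<open>k\<close> and independent of \<sigma>, as Tannery's
  theorem demands. In bin \<open>k\<close>, \<open>p powr - \<sigma>\<close> lies between
  \<open>z ^ Suc k\<close> and \<open>z ^ k\<close>; \<open>power_gap_le\<close> and the hypothesis
  on \<open>bin_weight\<close> each supply one factor \<open>1 / Suc k\<close>.\<close>

lemma bin_weight_at_diff_bound:
  fixes \<sigma> :: real
  assumes \<sigma>: "\<sigma> > 0" and C: "\<And>k. bin_weight k \<le> C / real (Suc k)"
  shows "\<bar>bin_weight k * (2 powr - \<sigma>) ^ Suc k - bin_weight_at \<sigma> k\<bar> \<le> C * (1 / real (Suc k) ^ 2) + (1/2) ^ k"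
proof -
  define z where "z = 2 powr - \<sigma>"
  have z: "0 < z" "z < 1" using \<sigma> powr_less_mono[of "- \<sigma>" 0 2] by (auto simp: z_def)
  have zk: "z ^ j = (2 ^ j) powr - \<sigma>" for j
    by (simp add: z_def powr_power powr_powr mult.commute flip: powr_realpow)
  let ?Q = "\<lambda>p. 1 / (real p * (real p - 1))"
  have each: "\<bar>- ln (1 - 1 / real p) * z ^ Suc k - - ln (1 - real p powr - (1 + \<sigma>))\<bar>
      \<le> (1 - z) * z ^ k * (- ln (1 - 1 / real p)) + ?Q p" if p: "p \<in> prime_bin k" for p
  proof -
    note p = prime_binD[OF p]
    define t where "t = real p powr - \<sigma>"
    have t1: "z ^ Suc k \<le> t" unfolding t_def zk using p \<sigma> by (intro powr_mono2') auto
    have t2: "t \<le> z ^ k" unfolding t_def zk using p \<sigma> by (intro powr_mono2') (linarith | simp)+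
    have "t \<le> z ^ k" "z ^ k \<le> 1" using t2 z by (auto intro: power_le_one)
    then have t: "0 \<le> t" "t \<le> 1" by (auto simp: t_def)
    have tp: "real p powr - (1 + \<sigma>) = t / real p"
      using p by (simp add: t_def powr_diff powr_minus field_simps)
    note b = one_minus_prime_bounds[of "real p" t] one_minus_prime_bounds[of "real p" 1]
    define w where "w = - ln (1 - 1 / real p)"
    define h where "h = - ln (1 - t / real p)"
    have w: "1 / real p \<le> w" "w \<le> 1 / real p + ?Q p" using b p by (auto simp: w_def)
    have h: "t / real p \<le> h" "h \<le> t / real p + ?Q p" using b p t by (auto simp: h_def)
    have y: "0 \<le> z ^ Suc k" "z ^ Suc k \<le> 1" using z by (auto intro: power_le_one simp del: power_Suc)
    have Q: "?Q p \<ge> 0" using p by auto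
    have gap: "(t - z ^ Suc k) / real p \<le> (1 - z) * z ^ k * w"
    proof -
      have "(t - z ^ Suc k) / real p = (t - z ^ Suc k) * (1 / real p)" by simp
      also have "\<dots> \<le> ((1 - z) * z ^ k) * w"
        using w t1 t2 z p by (intro mult_mono) (auto simp: algebra_simps)
      finally show ?thesis .
    qed
    have "w * z ^ Suc k \<le> (1 / real p + ?Q p) * z ^ Suc k"
      using w y by (intro mult_right_mono) auto
    also have "\<dots> \<le> z ^ Suc k / real p + ?Q p * 1"
      unfolding distrib_right using y Q by (intro add_mono mult_left_mono) auto
    also have "z ^ Suc k / real p \<le> t / real p" using t1 p by (intro divide_right_mono) auto
    finally have "w * z ^ Suc k - h \<le> ?Q p" using h by simp
    moreover have "(1 - z) * z ^ k * w \<ge> 0" using z w p by (intro mult_nonneg_nonneg) (auto intro: order_trans[OF _ w(1)])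
    moreover have "h - w * z ^ Suc k \<le> (1 - z) * z ^ k * w + ?Q p"
    proof -
      have "(1 / real p) * z ^ Suc k \<le> w * z ^ Suc k" using w y by (intro mult_right_mono)
      then have "h - w * z ^ Suc k \<le> (t - z ^ Suc k) / real p + ?Q p"
        using h(2) by (simp add: diff_divide_distrib del: power_Suc)
      with gap show ?thesis by linarith
    qed
    ultimately show ?thesis using Q unfolding tp w_def [symmetric] h_def [symmetric] by linarith
  qed
  have "\<bar>bin_weight k * z ^ Suc k - bin_weight_at \<sigma> k\<bar>
      = \<bar>\<Sum>p\<in>prime_bin k. - ln (1 - 1 / real p) * z ^ Suc k - - ln (1 - real p powr - (1 + \<sigma>))\<bar>"
    unfolding bin_weight_def bin_weight_at_def sum_subtractf sum_distrib_right ..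
  also have "\<dots> \<le> (\<Sum>p\<in>prime_bin k. \<bar>- ln (1 - 1 / real p) * z ^ Suc k - - ln (1 - real p powr - (1 + \<sigma>))\<bar>)"
    by (rule sum_abs)
  also have "\<dots> \<le> (\<Sum>p\<in>prime_bin k. (1 - z) * z ^ k * (- ln (1 - 1 / real p)) + ?Q p)"
    by (intro sum_mono each)
  also have "\<dots> = (1 - z) * z ^ k * bin_weight k + (\<Sum>p\<in>prime_bin k. ?Q p)"
    unfolding sum.distrib bin_weight_def sum_distrib_left ..
  also have "\<dots> \<le> (1 / real (Suc k)) * (C / real (Suc k)) + (1/2) ^ k"
  proof (intro add_mono mult_mono power_gap_le C prime_bin_square_sum)
    show "0 \<le> bin_weight k" unfolding bin_weight_def
    proof (rule sum_nonneg)
      fix p assume "p \<in> prime_bin k"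
      then have "real p \<ge> 2" by (rule prime_binD)
      then have "1 / real p \<le> - ln (1 - 1 / real p)" by (rule one_minus_prime_bounds) auto
      then show "0 \<le> - ln (1 - 1 / real p)" by (rule order_trans [rotated]) simp
    qed
  qed (use z in auto)
  finally show ?thesis by (simp add: z_def power2_eq_square)
qed

text \<open>
  The limit exists by summation by parts, so it equals the limit of the Abel means. With \<open>z\<close> equal to \<open>2\<close> to the \<open>-\<sigma>\<close>, the Euler
  product turns the Abel mean of the bin weights into \<open>log \<zeta>(1 + \<sigma>) = - log \<sigma> + o(1)\<close>, while the harmonic series becomes
  \<open>- log (1 - z) = - log (\<sigma> log 2) + o(1)\<close>; the difference \<open>log log 2\<close> reflects binning by powers of \<open>2\<close>.
\<close>

lemma mertens_constant:
  "(\<lambda>K. mertens_sum K - (\<Sum>k<K. 1 / real (Suc k))) \<longlonglongrightarrow> ln (ln 2)"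
proof -
  obtain C where C: "\<And>k. bin_weight k \<le> C / real (Suc k)" using bin_weight_estimates(2) by blast
  define a where "a k = bin_weight k - 1 / real (Suc k)" for k
  obtain c where c: "a sums c" using bin_weight_estimates(1) by (auto simp: a_def[abs_def] summable_def)
  define Z where "Z \<sigma> = (\<Sum>m. real m powr - (1 + \<sigma>))" for \<sigma>
  have Z: "(\<lambda>m. real m powr - (1 + \<sigma>)) sums Z \<sigma>" "1 \<le> \<sigma> * Z \<sigma>" "\<sigma> * Z \<sigma> \<le> 1 + \<sigma>" "Z \<sigma> > 0" if "\<sigma> > 0" for \<sigma>
  proof -
    from zeta_bounds[OF that] show "(\<lambda>m. real m powr - (1 + \<sigma>)) sums Z \<sigma>" "1 \<le> \<sigma> * Z \<sigma>" "\<sigma> * Z \<sigma> \<le> 1 + \<sigma>"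
      by (auto simp: Z_def sums_iff)
    then show "Z \<sigma> > 0" using that by (smt (verit) zero_less_mult_pos)
  qed
  define z where "z \<sigma> = 2 powr - \<sigma>" for \<sigma> :: real
  have z: "0 < z \<sigma>" "z \<sigma> < 1" if "\<sigma> > 0" for \<sigma>
    using that powr_less_mono[of "- \<sigma>" 0 2] by (auto simp: z_def)
  define D where "D k \<sigma> = bin_weight k * z \<sigma> ^ Suc k - bin_weight_at \<sigma> k" for k \<sigma>
  have right: "\<forall>\<^sub>F \<sigma> in at_right 0. (\<sigma>::real) > 0" by (simp add: eventually_at_right_less)
  \<comment> \<open>Dominated convergence for series: replacing each
    \<open>p powr - \<sigma>\<close> by the common value \<open>z \<sigma> ^ Suc k\<close> of its
    bin changes nothing in the limit.\<close>
  have "(\<forall>\<^sub>F \<sigma> in at_right 0. summable (\<lambda>k. norm (D k \<sigma>))) \<and> summable (\<lambda>k::nat. norm (0::real)) \<and>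
      ((\<lambda>\<sigma>. suminf (\<lambda>k. D k \<sigma>)) \<longlongrightarrow> suminf (\<lambda>k. 0)) (at_right 0)"
  proof (rule tannerys_theorem)
    show "((\<lambda>\<sigma>. D k \<sigma>) \<longlongrightarrow> 0) (at_right 0)" for k
    proof -
      have "((\<lambda>\<sigma>. D k \<sigma>) \<longlongrightarrow> bin_weight k * (2 powr - 0) ^ Suc k - (\<Sum>p\<in>prime_bin k. - ln (1 - real p powr - (1 + 0)))) (at_right 0)"
        unfolding D_def bin_weight_at_def z_def
        by (intro tendsto_intros) (auto simp: powr_minus dest!: prime_binD(1))
      moreover have "(\<Sum>p\<in>prime_bin k. - ln (1 - real p powr - (1 + 0))) = bin_weight k"
        unfolding bin_weight_def by (intro sum.cong refl) (auto simp: powr_minus divide_inverse dest!: prime_binD(1))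
      ultimately show ?thesis by simp
    qed
    have "\<forall>\<^sub>F (k :: nat, \<sigma>) in at_top \<times>\<^sub>F at_right 0. \<sigma> > (0 :: real)"
      using right by (subst eventually_prod2) simp_all
    then show "\<forall>\<^sub>F (k, \<sigma>) in at_top \<times>\<^sub>F at_right 0. norm (D k \<sigma>) \<le> C * (1 / real (Suc k) ^ 2) + (1/2) ^ k"
    proof (rule eventually_mono, safe)
      fix k :: nat and \<sigma> :: real assume "\<sigma> > 0"
      then show "norm (D k \<sigma>) \<le> C * (1 / real (Suc k) ^ 2) + (1/2) ^ k"
        unfolding D_def z_def real_norm_def by (rule bin_weight_at_diff_bound) (rule C)
    qed
    have "summable (\<lambda>k. 1 / real (Suc k) ^ 2)"
      using inverse_squares_sums by (simp add: sums_iff add.commute)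
    then show "summable (\<lambda>k. C * (1 / real (Suc k) ^ 2) + (1/2) ^ k)"
      by (intro summable_add summable_mult) (auto simp: summable_geometric)
  qed auto
  then have D0: "((\<lambda>\<sigma>. suminf (\<lambda>k. D k \<sigma>)) \<longlongrightarrow> 0) (at_right 0)"
    and D_summable: "\<forall>\<^sub>F \<sigma> in at_right 0. summable (\<lambda>k. D k \<sigma>)"
    by (auto elim!: eventually_mono intro: summable_norm_cancel)
  have zlim: "filterlim z (at_left 1) (at_right 0)" unfolding z_def by real_asymp
  have "((\<lambda>\<sigma>. \<Sum>k. a k * z \<sigma> ^ k) \<longlongrightarrow> c) (at_right 0)"
    by (rule filterlim_compose[OF Abel_limit_at_left_1(1)[OF c] zlim])
  moreover have "(z \<longlongrightarrow> 1) (at_right 0)" using zlim by (simp add: filterlim_at)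
  \<comment> \<open>The extra factor \<open>z \<sigma>\<close> shifts the exponent: Abel's theorem
    speaks of \<open>z ^ k\<close>, while \<open>D\<close> and the logarithmic series carry
    \<open>z ^ Suc k\<close>.\<close>
  ultimately have A: "((\<lambda>\<sigma>. z \<sigma> * (\<Sum>k. a k * z \<sigma> ^ k) - suminf (\<lambda>k. D k \<sigma>)) \<longlongrightarrow> 1 * c - 0) (at_right 0)"
    by (intro tendsto_intros D0)
  have "\<forall>\<^sub>F \<sigma> in at_right 0. z \<sigma> * (\<Sum>k. a k * z \<sigma> ^ k) - suminf (\<lambda>k. D k \<sigma>) = ln (\<sigma> * Z \<sigma>) + ln ((1 - z \<sigma>) / \<sigma>)"
    using right D_summable
  proof eventually_elim
    case (elim \<sigma>)
    have as: "summable (\<lambda>k. a k * z \<sigma> ^ k)" using Abel_limit_at_left_1(2)[OF c] z[OF elim(1)] by simp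
    have "(\<lambda>k. z \<sigma> * (a k * z \<sigma> ^ k) - D k \<sigma>) sums (z \<sigma> * (\<Sum>k. a k * z \<sigma> ^ k) - suminf (\<lambda>k. D k \<sigma>))"
      using as elim by (intro sums_diff sums_mult summable_sums)
    also have "(\<lambda>k. z \<sigma> * (a k * z \<sigma> ^ k) - D k \<sigma>) = (\<lambda>k. bin_weight_at \<sigma> k - z \<sigma> ^ Suc k / real (Suc k))"
      by (auto simp: a_def D_def algebra_simps)
    finally have "(\<lambda>k. bin_weight_at \<sigma> k - z \<sigma> ^ Suc k / real (Suc k)) sums
        (z \<sigma> * (\<Sum>k. a k * z \<sigma> ^ k) - suminf (\<lambda>k. D k \<sigma>))" .
    moreover have "(\<lambda>k. bin_weight_at \<sigma> k - z \<sigma> ^ Suc k / real (Suc k)) sums (ln (Z \<sigma>) - - ln (1 - z \<sigma>))"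
      using z[OF elim(1)] Z[OF elim(1)] elim by (intro sums_diff bin_weight_at_sums ln_one_minus_sums) auto
    ultimately have "z \<sigma> * (\<Sum>k. a k * z \<sigma> ^ k) - suminf (\<lambda>k. D k \<sigma>) = ln (Z \<sigma>) + ln (1 - z \<sigma>)"
      using sums_unique2 by fastforce
    \<comment> \<open>\<open>ln (Z \<sigma>)\<close> and \<open>ln (1 - z \<sigma>)\<close> both
      diverge; moving a factor \<sigma> between them leaves two convergent logarithms.\<close>
    also have "\<dots> = ln (\<sigma> * Z \<sigma>) + ln ((1 - z \<sigma>) / \<sigma>)"
      using elim(1) z[OF elim(1)] Z(4)[OF elim(1)] by (simp add: ln_mult ln_div)
    finally show ?case .
  qed
  with A have "((\<lambda>\<sigma>. ln (\<sigma> * Z \<sigma>) + ln ((1 - z \<sigma>) / \<sigma>)) \<longlongrightarrow> c) (at_right 0)"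
    by (simp add: tendsto_cong)
  moreover have "((\<lambda>\<sigma>. ln (\<sigma> * Z \<sigma>) + ln ((1 - z \<sigma>) / \<sigma>)) \<longlongrightarrow> ln 1 + ln (ln 2)) (at_right 0)"
  proof (intro tendsto_intros)
    have "((\<lambda>\<sigma>. 1 + \<sigma>) \<longlongrightarrow> 1 + 0) (at_right (0::real))" by (intro tendsto_intros)
    then have lim: "((\<lambda>\<sigma>. 1 + \<sigma>) \<longlongrightarrow> 1) (at_right (0::real))" by simp
    show "((\<lambda>\<sigma>. \<sigma> * Z \<sigma>) \<longlongrightarrow> 1) (at_right 0)"
    proof (rule tendsto_sandwich[OF _ _ tendsto_const lim])
      show "\<forall>\<^sub>F \<sigma> in at_right 0. 1 \<le> \<sigma> * Z \<sigma>"
        using right by eventually_elim (rule Z)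
      show "\<forall>\<^sub>F \<sigma> in at_right 0. \<sigma> * Z \<sigma> \<le> 1 + \<sigma>"
        using right by eventually_elim (rule Z)
    qed
    show "((\<lambda>\<sigma>. (1 - z \<sigma>) / \<sigma>) \<longlongrightarrow> ln 2) (at_right 0)" unfolding z_def by real_asymp
  qed auto
  ultimately have "c = ln 1 + ln (ln 2)" by (rule tendsto_unique[rotated]) simp
  then have "c = ln (ln 2)" by simp
  with c show ?thesis
    unfolding sums_def a_def by (simp add: sum_subtractf mertens_sum_eq)
qed

lemma harm_conv_sum: "harm K = (\<Sum>k<K. 1 / real (Suc k))"
  unfolding harm_def by (rule sum.reindex_bij_witness[of _ Suc "\<lambda>k. k - 1"]) (auto simp: field_simps)

theorem mertens_third:
  "(\<lambda>K. mertens_sum K - ln (real K)) \<longlonglongrightarrow> euler_mascheroni + ln (ln 2)"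
proof -
  have "(\<lambda>K. (harm K - ln (real K)) + (mertens_sum K - harm K)) \<longlonglongrightarrow> euler_mascheroni + ln (ln 2)"
    using mertens_constant by (intro tendsto_add euler_mascheroni_LIMSEQ) (simp add: harm_conv_sum)
  then show ?thesis by simp
qed

lemma mertens_sum_bounded:
  "\<exists>C\<ge>0. \<forall>K. \<bar>mertens_sum K - ln (real K)\<bar> \<le> C"
proof -
  have "Bseq (\<lambda>K. mertens_sum K - ln (real K))"
    using mertens_third by (intro convergent_imp_Bseq convergentI)
  then obtain C where "C > 0" "\<And>K. norm (mertens_sum K - ln (real K)) \<le> C"
    unfolding Bseq_def by blast
  then show ?thesis by (intro exI[of _ C]) auto
qed

section \<open>Integers without small prime factors\<close>

text \<open>The cutoff is real because each sieving step replaces it by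
  \<open>x / p\<close>.\<close>

definition sifted :: "nat set \<Rightarrow> real \<Rightarrow> nat set" where
  "sifted P x = {m\<in>coprime_to P. 1 \<le> m \<and> real m \<le> x}"

lemma finite_sifted [simp]: "finite (sifted P x)"
proof (rule finite_subset)
  show "sifted P x \<subseteq> {..nat \<lfloor>x\<rfloor>}" by (auto simp: sifted_def le_nat_iff le_floor_iff)
qed simp

lemma sifted_of_nat: "sifted P (real n) = {1..n} \<inter> coprime_to P"
  by (auto simp: sifted_def)

text \<open>
  The recursion \<open>N(P \<union> {p}, x) = N(P, x) - N(P, x / p)\<close> reproduces an error bound of this shape exactly, so
  Rankin's trick needs no sum over divisors. The exponent must be at most \<open>1\<close> for \<open>x < 1\<close>.
\<close>

lemma rankin_sieve:
  fixes x \<alpha> :: real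
  assumes "finite P" "\<And>p. p \<in> P \<Longrightarrow> prime p" "0 \<le> \<alpha>" "\<alpha> \<le> 1" "x \<ge> 0"
  shows "\<bar>real (card (sifted P x)) - x * (\<Prod>p\<in>P. 1 - 1 / real p)\<bar>
    \<le> x powr \<alpha> * (\<Prod>p\<in>P. 1 + real p powr - \<alpha>)"
  using assms(1,2,5)
proof (induction P arbitrary: x rule: finite_induct)
  case empty
  have "sifted {} x = {1..nat \<lfloor>x\<rfloor>}"
    using empty by (auto simp: sifted_def coprime_to_def le_nat_iff le_floor_iff)
  then have card: "real (card (sifted {} x)) = of_int \<lfloor>x\<rfloor>"
    using empty by simp
  have "\<bar>of_int \<lfloor>x\<rfloor> - x\<bar> \<le> x powr \<alpha>"
  proof (cases "x < 1")
    case True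
    then have "\<lfloor>x\<rfloor> = 0" using empty by (simp add: floor_eq_iff)
    moreover have "x \<le> x powr \<alpha>"
    proof (cases "x = 0")
      case False
      then have "x powr 1 \<le> x powr \<alpha>" using True empty assms by (intro powr_mono') auto
      with False empty show ?thesis by simp
    qed simp
    ultimately show ?thesis using empty by simp
  next
    case False
    then have "1 \<le> x powr \<alpha>" using assms by (intro ge_one_powr_ge_zero) auto
    moreover have "\<bar>of_int \<lfloor>x\<rfloor> - x\<bar> \<le> 1" by linarith
    ultimately show ?thesis by linarith
  qed
  then show ?case using card by simp
next
  case (insert p P)
  have p: "real p \<ge> 2" using prime_ge_2_nat insert(4)[of p] by simp
  have mem: "(\<lambda>m. p * m) ` sifted P (x / real p) = {m\<in>(\<lambda>m. p * m) ` coprime_to P. 1 \<le> m \<and> real m \<le> x}"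
    using p by (auto simp: sifted_def pos_le_divide_eq mult.commute)
  have ci: "coprime_to (insert p P) = coprime_to P - (\<lambda>m. p * m) ` coprime_to P"
    "(\<lambda>m. p * m) ` coprime_to P \<subseteq> coprime_to P"
    by (rule coprime_to_insert; use insert in blast)+
  have ins: "sifted (insert p P) x = sifted P x - (\<lambda>m. p * m) ` sifted P (x / real p)"
    unfolding mem unfolding sifted_def ci(1) by blast
  have sub: "(\<lambda>m. p * m) ` sifted P (x / real p) \<subseteq> sifted P x"
    unfolding mem unfolding sifted_def using ci(2) by blast
  have "card (sifted (insert p P) x) = card (sifted P x) - card (sifted P (x / real p))"
    unfolding ins using sub p by (subst card_Diff_subset) (auto simp: card_image inj_on_def)
  moreover have "card (sifted P (x / real p)) \<le> card (sifted P x)"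
    using card_mono[OF _ sub] p by (auto simp: card_image inj_on_def)
  ultimately have card: "real (card (sifted (insert p P) x)) = real (card (sifted P x)) - real (card (sifted P (x / real p)))"
    by simp
  define V where "V = (\<Prod>p\<in>P. 1 - 1 / real p)"
  define W where "W = (\<Prod>p\<in>P. 1 + real p powr - \<alpha>)"
  have "\<bar>real (card (sifted P x)) - x * V\<bar> \<le> x powr \<alpha> * W"
    "\<bar>real (card (sifted P (x / real p))) - x / real p * V\<bar> \<le> (x / real p) powr \<alpha> * W"
    unfolding V_def W_def by (rule insert.IH; use insert.prems p in simp)+
  moreover have pw: "(x / real p) powr \<alpha> = x powr \<alpha> * real p powr - \<alpha>"
    using insert p by (simp add: powr_divide powr_minus_divide)
  ultimately have "\<bar>real (card (sifted (insert p P) x)) - (x * V - x / real p * V)\<bar> \<le> x powr \<alpha> * W + x powr \<alpha> * real p powr - \<alpha> * W"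
    unfolding card pw by linarith
  then show ?case
    using insert(1,2) by (simp add: V_def W_def algebra_simps)
qed

section \<open>Reciprocal sums and an upper bound for rough integers at every level\<close>

definition smooth_le :: "nat set \<Rightarrow> nat \<Rightarrow> nat set" where
  "smooth_le P n = {m\<in>{1..n}. \<forall>p. prime p \<longrightarrow> p dvd m \<longrightarrow> p \<in> P}"

text \<open>A finite form of the Euler product. An integer built from \<open>insert p P\<close>
  either avoids \<open>p\<close> or is \<open>p\<close> times another such integer, again at most
  \<open>n\<close>. The full sum \<open>S\<close> is therefore at most the old sum plus
  \<open>S / p\<close>, which is solved for \<open>S\<close>.\<close>

lemma sum_inverse_smooth_le:
  assumes "finite P" "\<And>p. p \<in> P \<Longrightarrow> prime p"
  shows "(\<Sum>m\<in>smooth_le P n. 1 / real m) \<le> (\<Prod>p\<in>P. 1 / (1 - 1 / real p))"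
  using assms
proof (induction P rule: finite_induct)
  case empty
  have "smooth_le {} n \<subseteq> {1}"
    using prime_factor_nat by (fastforce simp: smooth_le_def)
  then have "(\<Sum>m\<in>smooth_le {} n. 1 / real m) \<le> (\<Sum>m\<in>{1::nat}. 1 / real m)"
    by (intro sum_mono2) auto
  then show ?case by simp
next
  case (insert p P)
  have p: "prime p" "real p \<ge> 2" using prime_ge_2_nat insert(4)[of p] by simp_all
  define S where "S = (\<Sum>m\<in>smooth_le (insert p P) n. 1 / real m)"
  have fin: "finite (smooth_le Q n)" for Q by (simp add: smooth_le_def)
  have sub: "smooth_le (insert p P) n \<subseteq> smooth_le P n \<union> (\<lambda>m. p * m) ` smooth_le (insert p P) n"
  proof
    fix m assume m: "m \<in> smooth_le (insert p P) n"
    show "m \<in> smooth_le P n \<union> (\<lambda>m. p * m) ` smooth_le (insert p P) n"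
    proof (cases "p dvd m")
      case False
      with m have "m \<in> smooth_le P n" by (auto simp: smooth_le_def)
      then show ?thesis by blast
    next
      case True
      then obtain j where j: "m = p * j" unfolding dvd_def by blast
      have jm: "j \<le> m" "j \<ge> 1" using m j p by (auto simp: smooth_le_def intro: Nat.gr0I)
      have mn: "m \<le> n" "\<And>q. prime q \<Longrightarrow> q dvd m \<Longrightarrow> q \<in> insert p P"
        using m by (auto simp: smooth_le_def)
      have "j \<le> n" using jm mn by linarith
      with jm mn j have "j \<in> smooth_le (insert p P) n" by (simp add: smooth_le_def)
      with j show ?thesis by blast
    qed
  qed
  have "S \<le> (\<Sum>m\<in>smooth_le P n \<union> (\<lambda>m. p * m) ` smooth_le (insert p P) n. 1 / real m)"
    unfolding S_def using sub fin by (intro sum_mono2) auto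
  also have "\<dots> \<le> (\<Sum>m\<in>smooth_le P n. 1 / real m) + (\<Sum>m\<in>(\<lambda>m. p * m) ` smooth_le (insert p P) n. 1 / real m)"
    using sum.union_inter[of "smooth_le P n" "(\<lambda>m. p * m) ` smooth_le (insert p P) n" "\<lambda>m. 1 / real m"] fin
      sum_nonneg[of "smooth_le P n \<inter> (\<lambda>m. p * m) ` smooth_le (insert p P) n" "\<lambda>m. 1 / real m"]
    by simp
  also have "(\<Sum>m\<in>(\<lambda>m. p * m) ` smooth_le (insert p P) n. 1 / real m) = S / real p"
    using p by (subst sum.reindex) (auto simp: inj_on_def S_def sum_divide_distrib mult.commute)
  finally have "S * (1 - 1 / real p) \<le> (\<Sum>m\<in>smooth_le P n. 1 / real m)" by (simp add: algebra_simps)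
  also have "\<dots> \<le> (\<Prod>p\<in>P. 1 / (1 - 1 / real p))" using insert by simp
  finally have "S \<le> (\<Prod>p\<in>P. 1 / (1 - 1 / real p)) / (1 - 1 / real p)"
    using p by (simp add: pos_le_divide_eq)
  then show ?case using insert by (simp add: S_def)
qed

definition rough :: "nat \<Rightarrow> nat \<Rightarrow> nat set" where
  "rough k n = {1..n} \<inter> coprime_to (primes_le (2 ^ k))"

lemma finite_rough [simp]: "finite (rough k n)"
  by (simp add: rough_def)

lemma prod_primes_le: "(\<Prod>p\<in>primes_le (2 ^ K). 1 - 1 / real p) = exp (- mertens_sum K)"
proof -
  have "exp (- mertens_sum K) = (\<Prod>p\<in>primes_le (2 ^ K). exp (ln (1 - 1 / real p)))"
    by (simp add: mertens_sum_def sum_negf exp_sum)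
  also have "\<dots> = (\<Prod>p\<in>primes_le (2 ^ K). 1 - 1 / real p)"
    by (intro prod.cong refl) (auto dest!: primes_le_ge_2 simp: field_simps)
  finally show ?thesis by simp
qed

lemma mertens_sum_mono: "k \<le> K \<Longrightarrow> mertens_sum k \<le> mertens_sum K"
  unfolding mertens_sum_def
proof (rule sum_mono2)
  fix p assume "p \<in> primes_le (2 ^ K) - primes_le (2 ^ k)"
  then have "real p \<ge> 2" using primes_le_ge_2 by blast
  then have "0 \<le> 1 / real p" "1 / real p \<le> - ln (1 - 1 / real p)"
    using one_minus_prime_bounds(1)[of p 1] by auto
  then show "0 \<le> - ln (1 - 1 / real p)" by linarith
next
  assume "k \<le> K"
  then show "primes_le (2 ^ k) \<subseteq> primes_le (2 ^ K)" by (intro primes_le_mono) simp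
qed simp

text \<open>A rough integer up to \<open>n\<close> uses only primes in
  \<open>(2 ^ k, 2 ^ N]\<close>. The bound is a quotient of two Mertens products, of order
  \<open>N / k\<close>.\<close>

lemma sum_inverse_rough_le:
  assumes "n \<le> 2 ^ N" "k \<le> N"
  shows "(\<Sum>m\<in>rough k n. 1 / real m) \<le> exp (mertens_sum N - mertens_sum k)"
proof -
  let ?P = "primes_le (2 ^ N) - primes_le (2 ^ k)"
  have sub: "primes_le (2 ^ k) \<subseteq> primes_le (2 ^ N)" using assms by (intro primes_le_mono) simp
  have "rough k n \<subseteq> smooth_le ?P n"
  proof
    fix m assume m: "m \<in> rough k n"
    have "p \<in> ?P" if "prime p" "p dvd m" for p
    proof -
      have "p \<le> m" using m that by (intro dvd_imp_le) (auto simp: rough_def)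
      also have "m \<le> 2 ^ N" using m assms by (auto simp: rough_def)
      finally show ?thesis using m that by (auto simp: rough_def coprime_to_def primes_le_iff)
    qed
    with m show "m \<in> smooth_le ?P n" by (simp add: rough_def smooth_le_def)
  qed
  then have "(\<Sum>m\<in>rough k n. 1 / real m) \<le> (\<Sum>m\<in>smooth_le ?P n. 1 / real m)"
    by (intro sum_mono2) (auto simp: smooth_le_def)
  also have "\<dots> \<le> (\<Prod>p\<in>?P. 1 / (1 - 1 / real p))"
    by (intro sum_inverse_smooth_le) (auto simp: primes_le_iff)
  also have "\<dots> = 1 / (\<Prod>p\<in>?P. 1 - 1 / real p)" by (simp add: prod_dividef)
  also have "\<dots> = 1 / ((\<Prod>p\<in>primes_le (2 ^ N). 1 - 1 / real p) / (\<Prod>p\<in>primes_le (2 ^ k). 1 - 1 / real p))"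
  proof -
    have "(\<Prod>p\<in>primes_le (2 ^ N). 1 - 1 / real p) = (\<Prod>p\<in>?P. 1 - 1 / real p) * (\<Prod>p\<in>primes_le (2 ^ k). 1 - 1 / real p)"
      using sub by (intro prod.subset_diff) auto
    moreover have "(\<Prod>p\<in>primes_le (2 ^ k). 1 - 1 / real p) \<noteq> 0" unfolding prod_primes_le by simp
    ultimately show ?thesis by simp
  qed
  also have "\<dots> = exp (mertens_sum N - mertens_sum k)"
    unfolding prod_primes_le by (simp add: exp_minus exp_diff field_simps)
  finally show ?thesis .
qed

text \<open>Reindexed by the cofactor \<open>j = m div p\<close>, which is again rough: for fixed
  \<open>j\<close> the primes are at most \<open>n div j\<close>, and Chebyshev bounds their
  contribution by \<open>4 * n / j\<close>.\<close>

lemma sum_ln_prime_divisors_rough: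
  "(\<Sum>m\<in>rough k n. \<Sum>p\<in>{p\<in>primes_le n. p dvd m}. ln (real p)) \<le> 4 * real n * (\<Sum>m\<in>rough k n. 1 / real m)"
proof -
  let ?S = "SIGMA m:rough k n. {p\<in>primes_le n. p dvd m}"
  let ?T = "SIGMA j:rough k n. primes_le (n div j)"
  let ?g = "\<lambda>(m, p). (m div p, p)"
  have p0: "p > 0" if "p \<in> primes_le n" for p n using primes_le_ge_2[OF that] by simp
  have inj: "inj_on ?g ?S"
    by (rule inj_onI) (clarsimp, metis dvd_mult_div_cancel)
  have sub: "?g ` ?S \<subseteq> ?T"
  proof
    fix x assume "x \<in> ?g ` ?S"
    then obtain m p where x: "x = (m div p, p)" and m: "m \<in> rough k n" and p: "p \<in> primes_le n" "p dvd m"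
      by auto
    obtain j where j: "m = p * j" using p(2) unfolding dvd_def by blast
    have pos: "p > 0" "j > 0" using p0[OF p(1)] m j by (auto simp: rough_def intro: Nat.gr0I)
    have "p * j \<le> n" using m j by (simp add: rough_def)
    moreover have "1 * j \<le> p * j" by (rule mult_le_mono1) (use pos in simp)
    ultimately have "j \<le> n" "p * j \<le> n" by linarith+
    moreover have "j \<in> coprime_to (primes_le (2 ^ k))" using m j by (auto simp: rough_def coprime_to_def)
    ultimately have "j \<in> rough k n" "p \<in> primes_le (n div j)"
      using pos p(1) by (auto simp: rough_def primes_le_iff less_eq_div_iff_mult_less_eq)
    then show "x \<in> ?T" using x j pos by simp
  qed
  have "(\<Sum>m\<in>rough k n. \<Sum>p\<in>{p\<in>primes_le n. p dvd m}. ln (real p)) = (\<Sum>x\<in>?S. ln (real (snd (?g x))))"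
    by (subst sum.Sigma) (auto simp: case_prod_unfold)
  also have "\<dots> = (\<Sum>x\<in>?g ` ?S. ln (real (snd x)))"
    using inj by (subst sum.reindex) (auto simp: o_def)
  also have "\<dots> \<le> (\<Sum>x\<in>?T. ln (real (snd x)))"
    using sub by (intro sum_mono2) (auto dest!: p0)
  also have "\<dots> = (\<Sum>j\<in>rough k n. theta (n div j))"
    unfolding theta_def by (subst sum.Sigma) (auto simp: case_prod_unfold)
  also have "\<dots> \<le> (\<Sum>j\<in>rough k n. 4 * (real n / real j))"
    by (intro sum_mono order_trans[OF theta_le] mult_left_mono of_nat_div_le_of_nat) auto
  also have "\<dots> = 4 * real n * (\<Sum>m\<in>rough k n. 1 / real m)"
    by (simp add: sum_distrib_left)
  finally show ?thesis .
qed

text \<open>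
  Write \<open>ln n = ln m + ln (n / m)\<close> for each rough \<open>m \<le> n\<close>; both parts are controlled by the sum of the \<open>1 / m\<close>,
  the first because the cofactor of a prime divisor of \<open>m\<close> is again rough.
\<close>

theorem card_rough_le:
  "\<exists>C\<ge>0. \<forall>k n. k \<ge> 1 \<longrightarrow> 2 ^ k \<le> n \<longrightarrow> real (card (rough k n)) \<le> C * real n / real k"
proof -
  obtain C where C: "\<And>n A. A \<subseteq> {1..n} \<Longrightarrow> \<bar>(\<Sum>m\<in>A. ln (real m) - (\<Sum>p\<in>{p\<in>primes_le n. p dvd m}. ln (real p)))\<bar> \<le> C * real n"
    using sum_ln_prime_divisors by blast
  have C0: "C \<ge> 0" using C[of "{}" 1] by simp
  obtain B where B: "B \<ge> 0" "\<And>K. \<bar>mertens_sum K - ln (real K)\<bar> \<le> B" using mertens_sum_bounded by blast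
  \<comment> \<open>In \<open>10\<close>, the factor \<open>5\<close> is \<open>4\<close> from the
    prime divisors plus \<open>1\<close> from \<open>ln (n / m)\<close>, and the factor
    \<open>2\<close> is the rounding of \<open>log 2 n\<close> up to \<open>N\<close>. Mertens'
    theorem is used at both ends of the range, whence \<open>exp (2 * B)\<close>.\<close>
  define M where "M = (C / ln 2 + 10 * exp (2 * B) / ln 2)"
  have "M \<ge> 0" using C0 by (simp add: M_def)
  moreover have "real (card (rough k n)) \<le> M * real n / real k" if k: "k \<ge> 1" "2 ^ k \<le> n" for k n
  proof -
    define N where "N = nat \<lceil>log 2 (real n)\<rceil>"
    have "(2::nat) ^ 1 \<le> 2 ^ k" using k by (intro power_increasing) auto
    then have n: "n \<ge> 2" using k by simp
    have "log 2 2 \<le> log 2 (real n)" using n by (subst log_le_cancel_iff) auto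
    then have log1: "log 2 (real n) \<ge> 1" by simp
    have N: "log 2 (real n) \<le> real N" "real N \<le> log 2 (real n) + 1" using log1 by (auto simp: N_def)
    have "real (2 ^ k) \<le> real n" using k of_nat_le_iff by blast
    then have "2 powr real k \<le> real n" by (simp add: powr_realpow)
    then have kl: "real k \<le> log 2 (real n)" using n by (subst le_log_iff) auto
    have "real n \<le> 2 powr real N" using N(1) n by (subst (asm) log_le_iff) auto
    then have "real n \<le> real (2 ^ N)" by (simp add: powr_realpow)
    then have nN: "n \<le> 2 ^ N" using of_nat_le_iff by blast
    have "real k \<le> real N" using kl N by linarith
    then have kN: "k \<le> N" by simp
    define s where "s = (\<Sum>m\<in>rough k n. 1 / real m)"
    have "s \<le> exp (mertens_sum N - mertens_sum k)"
      unfolding s_def by (rule sum_inverse_rough_le) fact+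
    also have "\<dots> \<le> exp (2 * B + (ln (real N) - ln (real k)))"
      using B(2)[of N] B(2)[of k] by (simp add: abs_le_iff)
    also have "\<dots> = exp (2 * B) * (real N / real k)"
      using k kN by (simp add: exp_add exp_diff)
    also have "\<dots> \<le> exp (2 * B) * (2 * log 2 (real n) / real k)"
      using N log1 k by (intro mult_left_mono divide_right_mono) auto
    finally have s: "s \<le> 2 * exp (2 * B) * (log 2 (real n) / real k)" by (simp add: mult_ac)
    have "real (card (rough k n)) * ln (real n) = (\<Sum>m\<in>rough k n. ln (real n))" by simp
    also have "\<dots> \<le> (\<Sum>m\<in>rough k n. ln (real m) + real n / real m)"
    proof (rule sum_mono)
      fix m assume "m \<in> rough k n"
      then have m: "m \<ge> 1" "m \<le> n" by (auto simp: rough_def)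
      have "ln (real n / real m) \<le> real n / real m - 1" using m n by (intro ln_le_minus_one) auto
      then show "ln (real n) \<le> ln (real m) + real n / real m" using m n by (simp add: ln_div)
    qed
    also have "\<dots> = (\<Sum>m\<in>rough k n. ln (real m)) + real n * s"
      by (simp add: sum.distrib s_def sum_distrib_left)
    also have "(\<Sum>m\<in>rough k n. ln (real m)) \<le> C * real n + 4 * real n * s"
      using C[of "rough k n" n] sum_ln_prime_divisors_rough[where k = k and n = n]
      by (auto simp: rough_def s_def sum_subtractf abs_le_iff)
    finally have "real (card (rough k n)) * ln (real n) \<le> C * real n + 5 * real n * s"
      by (simp add: mult_ac)
    also have "\<dots> \<le> C * real n * (log 2 (real n) / real k) + 5 * real n * (2 * exp (2 * B) * (log 2 (real n) / real k))"
    proof (intro add_mono mult_left_mono s)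
      \<comment> \<open>Here \<open>2 ^ k \<le> n\<close> enters: a bare \<open>O(n)\<close> is
        absorbed because \<open>log 2 n / k\<close> is at least 1.\<close>
      have "C * real n * 1 \<le> C * real n * (log 2 (real n) / real k)"
        using C0 kl k by (intro mult_left_mono) (auto simp: pos_le_divide_eq)
      then show "C * real n \<le> C * real n * (log 2 (real n) / real k)" by simp
    qed auto
    also have "\<dots> = (M * real n / real k) * ln (real n)"
      by (simp add: M_def log_def add_divide_distrib distrib_left distrib_right mult_ac)
    finally show ?thesis by (rule mult_right_le_imp_le) (use n in simp)
  qed
  ultimately show ?thesis by blast
qed

section \<open>The average of the logarithm of the least prime factor\<close>

text \<open>Cesaro's argument with weights \<open>1 / k\<close>, whose total \<open>harm K\<close>
  is asymptotic to \<open>ln K\<close>.\<close>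

lemma logarithmic_mean_tendsto:
  fixes a :: "nat \<Rightarrow> real"
  assumes "(\<lambda>k. real k * a k) \<longlonglongrightarrow> c"
  shows "(\<lambda>K. (\<Sum>k=1..K. a k) / ln (real K)) \<longlonglongrightarrow> c"
proof -
  define d where "d k = real k * a k - c" for k
  have "d \<longlonglongrightarrow> c - c" unfolding d_def by (intro tendsto_intros assms)
  then have d: "d \<longlonglongrightarrow> 0" by simp
  then have "Bseq d" by (intro convergent_imp_Bseq convergentI)
  then obtain M where M: "\<And>k. \<bar>d k\<bar> \<le> M" unfolding Bseq_def by auto
  have harm: "(\<lambda>K. harm K / ln (real K) :: real) \<longlonglongrightarrow> 1"
  proof -
    have "(\<lambda>K. (harm K - ln (real K)) * (1 / ln (real K)) + 1) \<longlonglongrightarrow> euler_mascheroni * 0 + 1"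
      by (intro tendsto_intros euler_mascheroni_LIMSEQ) real_asymp
    moreover have "\<forall>\<^sub>F K in sequentially. (harm K - ln (real K)) * (1 / ln (real K)) + 1 = harm K / ln (real K)"
      using eventually_gt_at_top[of 1] by eventually_elim (simp add: field_simps)
    ultimately show ?thesis by (simp add: tendsto_cong)
  qed
  have "(\<lambda>K. (\<Sum>k=1..K. d k / real k) / ln (real K)) \<longlonglongrightarrow> 0"
  proof (rule tendstoI)
    fix \<epsilon> :: real assume \<epsilon>: "\<epsilon> > 0"
    obtain k0 where k0: "\<And>k. k \<ge> k0 \<Longrightarrow> \<bar>d k\<bar> \<le> \<epsilon> / 2"
      using LIMSEQ_D[OF d, of "\<epsilon> / 2"] \<epsilon> by (auto intro: less_imp_le)
    have bound: "\<bar>\<Sum>k=1..K. d k / real k\<bar> \<le> real k0 * M + \<epsilon> / 2 * harm K" for K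
    proof -
      have "\<bar>\<Sum>k=1..K. d k / real k\<bar> \<le> (\<Sum>k=1..K. (if k < k0 then M else 0) + \<epsilon> / 2 * inverse (real k))"
      proof (rule order_trans[OF sum_abs], rule sum_mono)
        fix k assume k: "k \<in> {1..K}"
        show "\<bar>d k / real k\<bar> \<le> (if k < k0 then M else 0) + \<epsilon> / 2 * inverse (real k)"
        proof (cases "k < k0")
          case True
          have "\<bar>d k / real k\<bar> \<le> M / 1"
            unfolding abs_divide using M[of k] M[of 0] k by (intro frac_le) auto
          then show ?thesis using True \<epsilon> by (simp add: add_increasing2)
        next
          case False
          then have "\<bar>d k\<bar> \<le> \<epsilon> / 2" by (intro k0) simp
          then have "\<bar>d k\<bar> / real k \<le> \<epsilon> / 2 / real k" by (rule divide_right_mono) simp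
          moreover have "\<bar>d k / real k\<bar> = \<bar>d k\<bar> / real k" by simp
          ultimately show ?thesis using False by (simp only: if_False divide_inverse add_0_left)
        qed
      qed
      also have "\<dots> = (\<Sum>k=1..K. if k < k0 then M else 0) + \<epsilon> / 2 * harm K"
        by (simp add: sum.distrib harm_def sum_distrib_left)
      also have "(\<Sum>k=1..K. if k < k0 then M else 0) = (\<Sum>k\<in>{k\<in>{1..K}. k < k0}. M)"
        by (rule sum.inter_filter [symmetric]) simp
      also have "\<dots> \<le> (\<Sum>k<k0. M)"
        by (rule sum_mono2) (use M[of 0] in auto)
      finally show ?thesis by simp
    qed
    have "(\<lambda>K. real k0 * M * (1 / ln (real K)) + \<epsilon> / 2 * (harm K / ln (real K))) \<longlonglongrightarrow> real k0 * M * 0 + \<epsilon> / 2 * 1"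
      by (intro tendsto_intros harm) real_asymp
    then have "\<forall>\<^sub>F K in sequentially. real k0 * M * (1 / ln (real K)) + \<epsilon> / 2 * (harm K / ln (real K)) < \<epsilon>"
      by (rule order_tendstoD) (use \<epsilon> in simp)
    then show "\<forall>\<^sub>F K in sequentially. dist ((\<Sum>k=1..K. d k / real k) / ln (real K)) 0 < \<epsilon>"
      using eventually_gt_at_top[of 1]
    proof eventually_elim
      case (elim K)
      have "\<bar>(\<Sum>k=1..K. d k / real k) / ln (real K)\<bar> \<le> (real k0 * M + \<epsilon> / 2 * harm K) / ln (real K)"
        using elim bound[of K] by (simp add: abs_divide divide_right_mono)
      also have "\<dots> = real k0 * M * (1 / ln (real K)) + \<epsilon> / 2 * (harm K / ln (real K))"
        by (simp add: add_divide_distrib)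
      also have "\<dots> < \<epsilon>" by fact
      finally show ?case by (simp add: dist_real_def)
    qed
  qed
  then have "(\<lambda>K. c * (harm K / ln (real K)) + (\<Sum>k=1..K. d k / real k) / ln (real K)) \<longlonglongrightarrow> c * 1 + 0"
    by (intro tendsto_intros harm)
  moreover have "c * (harm K / ln (real K)) + (\<Sum>k=1..K. d k / real k) / ln (real K) = (\<Sum>k=1..K. a k) / ln (real K)" for K
  proof -
    have "(\<Sum>k=1..K. a k) = (\<Sum>k=1..K. c * inverse (real k) + d k / real k)"
      by (rule sum.cong) (auto simp: d_def field_simps)
    also have "\<dots> = c * harm K + (\<Sum>k=1..K. d k / real k)"
      by (simp add: sum.distrib harm_def sum_distrib_left)
    finally show ?thesis by (simp add: add_divide_distrib)
  qed
  ultimately show ?thesis by simp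
qed

text \<open>At \<open>x = 2 ^ k\<close> Mertens' product is asymptotic to
  \<open>exp (- gamma) / ln x\<close>, and \<open>ln x = k * ln 2\<close>.\<close>

lemma rough_density_tendsto:
  "(\<lambda>k. real k * exp (- mertens_sum k)) \<longlonglongrightarrow> exp (- euler_mascheroni) / ln 2"
proof -
  have "(\<lambda>k. exp (- (mertens_sum k - ln (real k)))) \<longlonglongrightarrow> exp (- (euler_mascheroni + ln (ln 2)))"
    by (intro tendsto_intros mertens_third)
  moreover have "\<forall>\<^sub>F k in sequentially. exp (- (mertens_sum k - ln (real k))) = real k * exp (- mertens_sum k)"
    using eventually_gt_at_top[of 0] by eventually_elim (simp add: exp_diff exp_minus field_simps)
  moreover have "exp (- (euler_mascheroni + ln (ln 2))) = exp (- euler_mascheroni) / ln (2::real)"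
    by (simp add: exp_diff)
  ultimately show ?thesis by (simp add: tendsto_cong)
qed

text \<open>Rankin's exponent is taken as \<open>1 - 1 / K\<close>. Primes up to
  \<open>2 ^ K\<close> satisfy \<open>p powr (1 / K) \<le> 2\<close>, so the product in the error is
  at most the square of the inverse Mertens product, while \<open>n powr \<alpha>\<close> saves
  \<open>exp (ln n / K)\<close>. One \<open>K\<close> serves all \<open>k \<le> K\<close>.\<close>

lemma rough_sieve:
  assumes "1 \<le> K" "k \<le> K" "n \<ge> 1"
  shows "\<bar>real (card (rough k n)) - real n * exp (- mertens_sum k)\<bar>
    \<le> real n * exp (- (ln (real n) / real K)) * exp (2 * mertens_sum K)"
proof -
  define \<alpha> where "\<alpha> = 1 - 1 / real K"
  have \<alpha>: "0 \<le> \<alpha>" "\<alpha> \<le> 1" using assms by (auto simp: \<alpha>_def)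
  have "\<bar>real (card (sifted (primes_le (2 ^ k)) (real n))) - real n * (\<Prod>p\<in>primes_le (2 ^ k). 1 - 1 / real p)\<bar>
    \<le> real n powr \<alpha> * (\<Prod>p\<in>primes_le (2 ^ k). 1 + real p powr - \<alpha>)"
    by (intro rankin_sieve \<alpha>) (auto simp: primes_le_iff)
  then have "\<bar>real (card (rough k n)) - real n * exp (- mertens_sum k)\<bar>
    \<le> real n powr \<alpha> * (\<Prod>p\<in>primes_le (2 ^ k). 1 + real p powr - \<alpha>)"
    by (simp add: sifted_of_nat rough_def prod_primes_le)
  also have "\<dots> \<le> real n powr \<alpha> * exp (2 * mertens_sum K)"
  proof (rule mult_left_mono)
    have "(\<Prod>p\<in>primes_le (2 ^ k). 1 + real p powr - \<alpha>) \<le> (\<Prod>p\<in>primes_le (2 ^ k). exp (2 * (- ln (1 - 1 / real p))))"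
    proof (rule prod_mono, safe)
      fix p assume p: "p \<in> primes_le (2 ^ k)"
      note p2 = primes_le_ge_2[OF p]
      have "(2::nat) ^ k \<le> 2 ^ K" using assms by (intro power_increasing) auto
      moreover have "p \<le> 2 ^ k" using p by (simp add: primes_le_iff)
      ultimately have "p \<le> 2 ^ K" by linarith
      then have "real p \<le> real (2 ^ K)" using of_nat_le_iff by blast
      then have "real p powr (1 / real K) \<le> (2 powr real K) powr (1 / real K)"
        by (intro powr_mono2) (auto simp: powr_realpow)
      then have "real p powr (1 / real K) \<le> 2" using assms by (simp add: powr_powr)
      then have "real p powr - \<alpha> \<le> 2 / real p"
        using p2 by (simp add: \<alpha>_def powr_diff divide_right_mono)
      also have "\<dots> \<le> 2 * (- ln (1 - 1 / real p))"
        using one_minus_prime_bounds(1)[of "real p" 1] p2 by simp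
      finally show "1 + real p powr - \<alpha> \<le> exp (2 * (- ln (1 - 1 / real p)))"
        by (intro order_trans[OF _ exp_ge_add_one_self]) simp
    qed simp
    also have "\<dots> = exp (2 * mertens_sum k)"
      unfolding mertens_sum_def sum_distrib_left by (simp add: exp_sum)
    also have "\<dots> \<le> exp (2 * mertens_sum K)" using mertens_sum_mono[OF assms(2)] by simp
    finally show "(\<Prod>p\<in>primes_le (2 ^ k). 1 + real p powr - \<alpha>) \<le> exp (2 * mertens_sum K)" .
  qed simp
  also have "real n powr \<alpha> = real n * exp (- (ln (real n) / real K))"
    using assms by (simp add: \<alpha>_def powr_def left_diff_distrib exp_diff exp_minus divide_inverse)
  finally show ?thesis .
qed

lemma sum_inverse_interval_le:
  assumes "1 \<le> K" "K \<le> N"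
  shows "(\<Sum>k\<in>{K<..N}. 1 / real k) \<le> ln (real N / real K)"
  using assms(2)
proof (induction N rule: dec_induct)
  case (step N)
  have "1 / real (Suc N) \<le> ln (real (Suc N) / real N)"
  proof -
    have "ln (real N / real (Suc N)) \<le> real N / real (Suc N) - 1"
      using step assms by (intro ln_le_minus_one) auto
    also have "\<dots> = - (1 / real (Suc N))" by (simp add: field_simps)
    finally show ?thesis using step assms by (simp add: ln_div)
  qed
  moreover have "{K<..Suc N} = insert (Suc N) {K<..N}" using step by auto
  moreover have "ln (real (Suc N) / real K) = ln (real (Suc N) / real N) + ln (real N / real K)"
    using step assms by (simp add: ln_div)
  ultimately show ?case using step by simp
qed (use assms in simp)

text \<open>The levels up to \<open>K n\<close> already carry the whole main term, since
  \<open>ln (K n)\<close> is asymptotic to \<open>ln (ln n)\<close>. The levels from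
  \<open>K n\<close> to \<open>N n\<close> add only \<open>O(n ln (ln (ln n)))\<close>.\<close>

lemma sum_card_rough_asymp:
  defines "N \<equiv> \<lambda>n::nat. nat \<lfloor>log 2 (real n)\<rfloor>"
  shows "(\<lambda>n. real (\<Sum>k=1..N n. card (rough k n)) / (real n * ln (ln (real n)))) \<longlonglongrightarrow> exp (- euler_mascheroni) / ln 2"
proof -
  obtain C where "C \<ge> 0" and C: "\<And>k n. k \<ge> 1 \<Longrightarrow> 2 ^ k \<le> n \<Longrightarrow> real (card (rough k n)) \<le> C * real n / real k"
    using card_rough_le by blast
  obtain B where B: "\<And>K. \<bar>mertens_sum K - ln (real K)\<bar> \<le> B" using mertens_sum_bounded by blast
  \<comment> \<open>large enough for \<open>ln (\<kappa> n) ~ ln (ln n)\<close>, small enough for \<open>exp (- ln n / \<kappa> n)\<close> to beat every power of \<open>ln n\<close>\<close>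
  define \<kappa> where "\<kappa> n = ln (real n) / ln (ln (real n)) ^ 2" for n :: nat
  define K where "K n = nat \<lfloor>\<kappa> n\<rfloor>" for n
  define H where "H M = (\<Sum>k=1..M. exp (- mertens_sum k))" for M
  define S where "S n = real (\<Sum>k=1..N n. card (rough k n))" for n
  \<comment> \<open>The cube is at most \<open>ln n\<close> levels times the square from
    \<open>exp (2 * mertens_sum K)\<close>; its last factor bounds \<open>exp (- ln n / K)\<close>.
    The second summand is the harmonic sum over the levels beyond \<open>K n\<close>.\<close>
  define err where "err n = (ln (real n) ^ 3 * exp (2 * B) * exp (- (ln (ln (real n)) ^ 2))
    + C * ln ((ln (real n) / ln 2) / (\<kappa> n - 1))) / ln (ln (real n))" for n
  have err: "err \<longlonglongrightarrow> 0" unfolding err_def \<kappa>_def by real_asymp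
  have Hlim: "(\<lambda>M. H M / ln (real M)) \<longlonglongrightarrow> exp (- euler_mascheroni) / ln 2"
    unfolding H_def by (rule logarithmic_mean_tendsto[OF rough_density_tendsto])
  have "filterlim \<kappa> at_top sequentially" unfolding \<kappa>_def by real_asymp
  then have K_top: "filterlim K at_top sequentially"
    unfolding K_def by (intro filterlim_compose[OF filterlim_nat_sequentially]
      filterlim_compose[OF filterlim_floor_sequentially])
  have K_bounds: "\<kappa> n - 1 \<le> real (K n)" "\<kappa> n > 1 \<Longrightarrow> real (K n) \<le> \<kappa> n" for n
    unfolding K_def by linarith+
  have ev: "\<forall>\<^sub>F n in sequentially. n \<ge> 3 \<and> \<kappa> n > 2 \<and> \<kappa> n + 1 \<le> log 2 (real n) \<and> ln (ln (real n)) > 1 \<and> \<kappa> n \<le> ln (real n)"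
    unfolding \<kappa>_def by (intro eventually_conj; real_asymp)
  have lnK: "(\<lambda>n. ln (real (K n)) / ln (ln (real n))) \<longlonglongrightarrow> 1"
  proof (rule tendsto_sandwich)
    show "\<forall>\<^sub>F n in sequentially. ln (\<kappa> n - 1) / ln (ln (real n)) \<le> ln (real (K n)) / ln (ln (real n))"
      using ev
    proof eventually_elim
      case (elim n)
      then have "0 < \<kappa> n - 1" "\<kappa> n - 1 \<le> real (K n)" using K_bounds[of n] by linarith+
      with elim show ?case by (intro divide_right_mono) auto
    qed
    show "\<forall>\<^sub>F n in sequentially. ln (real (K n)) / ln (ln (real n)) \<le> ln (\<kappa> n) / ln (ln (real n))"
      using ev
    proof eventually_elim
      case (elim n)
      then have "0 < real (K n)" "real (K n) \<le> \<kappa> n" using K_bounds[of n] by linarith+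
      with elim show ?case by (intro divide_right_mono) auto
    qed
    show "(\<lambda>n. ln (\<kappa> n - 1) / ln (ln (real n))) \<longlonglongrightarrow> 1" unfolding \<kappa>_def by real_asymp
    show "(\<lambda>n. ln (\<kappa> n) / ln (ln (real n))) \<longlonglongrightarrow> 1" unfolding \<kappa>_def by real_asymp
  qed
  have "(\<lambda>n. H (K n) / ln (real (K n)) * (ln (real (K n)) / ln (ln (real n)))) \<longlonglongrightarrow> exp (- euler_mascheroni) / ln 2 * 1"
    by (intro tendsto_mult lnK filterlim_compose[OF Hlim K_top])
  moreover have "\<forall>\<^sub>F n in sequentially. H (K n) / ln (real (K n)) * (ln (real (K n)) / ln (ln (real n))) = H (K n) / ln (ln (real n))"
    using eventually_compose_filterlim[OF eventually_gt_at_top[of 1] K_top]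
    by eventually_elim simp
  ultimately have "(\<lambda>n. H (K n) / ln (ln (real n))) \<longlonglongrightarrow> exp (- euler_mascheroni) / ln 2 * 1"
    by (rule Lim_transform_eventually)
  then have main: "(\<lambda>n. H (K n) / ln (ln (real n))) \<longlonglongrightarrow> exp (- euler_mascheroni) / ln 2"
    by simp
  have diff: "\<forall>\<^sub>F n in sequentially. norm (S n / (real n * ln (ln (real n))) - H (K n) / ln (ln (real n))) \<le> err n"
    using ev
  proof eventually_elim
    case (elim n)
    define l where "l = ln (real n)"
    have l: "ln l > 1" "l > 0" using elim by (auto simp: l_def)
    then have l1: "l \<noteq> 1" by auto
    have Kn: "1 \<le> K n" "real (K n) \<le> \<kappa> n" "\<kappa> n - 1 \<le> real (K n)" "\<kappa> n - 1 > 0"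
      using elim K_bounds[of n] by linarith+
    have Nn: "real (N n) \<le> log 2 (real n)" "log 2 (real n) - 1 \<le> real (N n)"
      using elim unfolding N_def by linarith+
    have KN: "K n \<le> N n" using Kn Nn elim unfolding K_def N_def by linarith
    have pow: "2 ^ k \<le> n" if "k \<le> N n" for k
    proof -
      have "2 powr real k \<le> 2 powr log 2 (real n)" using that Nn by (intro powr_mono) auto
      also have "\<dots> = real n" using elim by simp
      finally have "real (2 ^ k) \<le> real n" by (simp add: powr_realpow)
      then show ?thesis using of_nat_le_iff by blast
    qed
    have S: "S n = (\<Sum>k=1..K n. real (card (rough k n))) + (\<Sum>k\<in>{K n<..N n}. real (card (rough k n)))"
      unfolding S_def of_nat_sum using KN
      by (subst sum.union_disjoint [symmetric]) (auto intro!: sum.cong)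
    have E1: "\<bar>(\<Sum>k=1..K n. real (card (rough k n))) - real n * H (K n)\<bar>
      \<le> real n * (l ^ 3 * exp (2 * B) * exp (- (ln l ^ 2)))"
    proof -
      have "\<bar>(\<Sum>k=1..K n. real (card (rough k n))) - real n * H (K n)\<bar>
        = \<bar>\<Sum>k=1..K n. real (card (rough k n)) - real n * exp (- mertens_sum k)\<bar>"
        by (simp add: H_def sum_subtractf sum_distrib_left)
      also have "\<dots> \<le> (\<Sum>k=1..K n. real n * exp (- (l / real (K n))) * exp (2 * mertens_sum (K n)))"
        unfolding l_def using Kn elim
        by (intro order_trans[OF sum_abs] sum_mono rough_sieve) auto
      also have "\<dots> = real n * (real (K n) * exp (2 * mertens_sum (K n)) * exp (- (l / real (K n))))"
        by simp
      also have "\<dots> \<le> real n * (l * (l ^ 2 * exp (2 * B)) * exp (- (ln l ^ 2)))"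
      proof (intro mult_left_mono mult_mono)
        show Kl: "real (K n) \<le> l" using Kn elim by (simp add: l_def)
        have "exp (2 * mertens_sum (K n)) \<le> exp (2 * (ln (real (K n)) + B))"
          using B[of "K n"] by (simp add: abs_le_iff)
        also have "\<dots> = real (K n) ^ 2 * exp (2 * B)"
          using Kn by (simp add: distrib_left exp_add exp_double)
        also have "\<dots> \<le> l ^ 2 * exp (2 * B)" using Kl by (intro mult_right_mono power_mono) auto
        finally show "exp (2 * mertens_sum (K n)) \<le> l ^ 2 * exp (2 * B)" .
        have "real (K n) * ln l ^ 2 \<le> \<kappa> n * ln l ^ 2" using Kn by (intro mult_right_mono) auto
        also have "\<dots> = l" using l l1 unfolding \<kappa>_def l_def [symmetric] by simp
        finally have "ln l ^ 2 \<le> l / real (K n)" using Kn by (simp add: pos_le_divide_eq mult.commute)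
        then show "exp (- (l / real (K n))) \<le> exp (- (ln l ^ 2))" by simp
      qed (use l in auto)
      finally show ?thesis by (simp add: power3_eq_cube power2_eq_square mult_ac)
    qed
    have E2: "(\<Sum>k\<in>{K n<..N n}. real (card (rough k n))) \<le> real n * (C * ln ((l / ln 2) / (\<kappa> n - 1)))"
    proof -
      have "(\<Sum>k\<in>{K n<..N n}. real (card (rough k n))) \<le> (\<Sum>k\<in>{K n<..N n}. C * real n / real k)"
        by (intro sum_mono C pow) auto
      also have "\<dots> = real n * (C * (\<Sum>k\<in>{K n<..N n}. 1 / real k))"
        by (simp add: sum_distrib_left mult_ac)
      also have "\<dots> \<le> real n * (C * ln ((l / ln 2) / (\<kappa> n - 1)))"
      proof (intro mult_left_mono)
        have "(\<Sum>k\<in>{K n<..N n}. 1 / real k) \<le> ln (real (N n) / real (K n))"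
          by (rule sum_inverse_interval_le) (use Kn KN in auto)
        also have "\<dots> \<le> ln ((l / ln 2) / (\<kappa> n - 1))"
        proof -
          have "real (N n) / real (K n) \<le> (l / ln 2) / (\<kappa> n - 1)"
            using Kn Nn l by (intro frac_le) (auto simp: l_def log_def)
          then show ?thesis using Kn KN by (subst ln_le_cancel_iff) (auto intro: order_less_le_trans[rotated])
        qed
        finally show "(\<Sum>k\<in>{K n<..N n}. 1 / real k) \<le> ln ((l / ln 2) / (\<kappa> n - 1))" .
      qed (use \<open>C \<ge> 0\<close> in auto)
      finally show ?thesis .
    qed
    have nonneg: "(\<Sum>k\<in>{K n<..N n}. real (card (rough k n))) \<ge> 0" by (intro sum_nonneg) auto
    have n: "real n > 0" using elim by simp
    have "\<bar>S n - real n * H (K n)\<bar> \<le> real n * (l ^ 3 * exp (2 * B) * exp (- (ln l ^ 2)) + C * ln ((l / ln 2) / (\<kappa> n - 1)))"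
      using E1 E2 nonneg unfolding S distrib_left by linarith
    also have "\<dots> = real n * ln l * err n"
      using l l1 by (simp add: err_def l_def [symmetric])
    finally have le: "\<bar>S n - real n * H (K n)\<bar> \<le> real n * ln l * err n" .
    have D: "real n * ln l > 0" using n l by (intro mult_pos_pos) linarith+
    have "\<bar>S n - real n * H (K n)\<bar> / (real n * ln l) \<le> err n"
      unfolding pos_divide_le_eq[OF D] using le by (simp only: mult.commute)
    moreover have "S n / (real n * ln l) - H (K n) / ln l = (S n - real n * H (K n)) / (real n * ln l)"
      using n l by (simp add: diff_divide_distrib)
    ultimately show ?case
      using D by (simp only: l_def [symmetric] real_norm_def abs_divide abs_of_pos)
  qed
  have "(\<lambda>n. S n / (real n * ln (ln (real n))) - H (K n) / ln (ln (real n))) \<longlonglongrightarrow> 0"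
    by (rule Lim_null_comparison[OF diff err])
  from tendsto_add[OF this main] show ?thesis by (simp add: S_def)
qed

text \<open>\<open>lpf 1\<close> is unspecified, hence the restriction to \<open>j \<ge> 2\<close> below.\<close>

definition lpf :: "nat \<Rightarrow> nat" where
  "lpf j = (LEAST p. prime p \<and> p dvd j)"

lemma
  assumes "j \<ge> 2"
  shows prime_lpf: "prime (lpf j)" and lpf_dvd: "lpf j dvd j"
proof -
  have "\<exists>p. prime p \<and> p dvd j" using assms by (intro prime_factor_nat) auto
  then have "prime (lpf j) \<and> lpf j dvd j" unfolding lpf_def by (rule LeastI_ex)
  then show "prime (lpf j)" "lpf j dvd j" by auto
qed

lemma lpf_le: "prime p \<Longrightarrow> p dvd j \<Longrightarrow> lpf j \<le> p"
  unfolding lpf_def by (intro Least_le) auto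

lemma lpf_bounds:
  assumes "j \<in> {2..n}"
  shows "2 \<le> lpf j" "lpf j \<le> n"
  using assms prime_ge_2_nat[OF prime_lpf[of j]] dvd_imp_le[OF lpf_dvd[of j]] by auto

text \<open>The integer 1 is rough at every level although it has no prime factor, so it is taken
  out.\<close>

lemma rough_eq_lpf: "rough k n - {1} = {j\<in>{2..n}. 2 ^ k < lpf j}"
proof (intro equalityI subsetI)
  fix j assume j: "j \<in> rough k n - {1}"
  then have "j \<in> {2..n}" by (auto simp: rough_def)
  with j prime_lpf[of j] lpf_dvd[of j] show "j \<in> {j\<in>{2..n}. 2 ^ k < lpf j}"
    by (auto simp: rough_def coprime_to_def primes_le_iff not_le [symmetric])
next
  fix j assume j: "j \<in> {j\<in>{2..n}. 2 ^ k < lpf j}"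
  then have "\<not> p dvd j" if "p \<in> primes_le (2 ^ k)" for p
    using lpf_le[of p j] that by (auto simp: primes_le_iff)
  with j show "j \<in> rough k n - {1}" by (auto simp: rough_def coprime_to_def)
qed

text \<open>The count is \<open>\<lceil>log 2 p\<rceil> - 1\<close>; the cap \<open>N\<close> cuts
  nothing off because \<open>p \<le> n\<close>. This discretises \<open>log 2 (lpf j)\<close> as the
  number of levels at which \<open>j\<close> is rough.\<close>

lemma card_powers_below:
  assumes "2 \<le> p" "real p \<le> real n" 
  defines "N \<equiv> nat \<lfloor>log 2 (real n)\<rfloor>"
  shows "\<bar>real (card {k\<in>{1..N}. 2 ^ k < p}) - log 2 (real p)\<bar> \<le> 1"
proof -
  define t where "t = log 2 (real p)"
  have "log 2 2 \<le> t" unfolding t_def using assms by (subst log_le_cancel_iff) auto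
  then have t1: "t \<ge> 1" by simp
  have tn: "t \<le> log 2 (real n)" unfolding t_def using assms by (subst log_le_cancel_iff) auto
  have iff: "2 ^ k < p \<longleftrightarrow> real k < t" for k
  proof -
    have "2 ^ k < p \<longleftrightarrow> real (2 ^ k) < real p" by (rule of_nat_less_iff [symmetric])
    also have "\<dots> \<longleftrightarrow> 2 powr real k < real p" by (simp add: powr_realpow)
    also have "\<dots> \<longleftrightarrow> real k < t" unfolding t_def using assms by (subst less_log_iff) auto
    finally show ?thesis .
  qed
  have "{k\<in>{1..N}. 2 ^ k < p} \<subseteq> {1..nat \<lfloor>t\<rfloor>}" unfolding iff by (auto simp: le_nat_iff le_floor_iff)
  from card_mono[OF _ this] have up: "card {k\<in>{1..N}. 2 ^ k < p} \<le> nat \<lfloor>t\<rfloor>" by simp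
  have "{1..nat \<lceil>t\<rceil> - 1} \<subseteq> {k\<in>{1..N}. 2 ^ k < p}"
  proof
    fix k assume "k \<in> {1..nat \<lceil>t\<rceil> - 1}"
    then have k: "1 \<le> k" "real k < t" using t1 by (auto; linarith)+
    then have "k \<le> N" using tn unfolding N_def by (simp add: le_nat_iff le_floor_iff)
    with k show "k \<in> {k\<in>{1..N}. 2 ^ k < p}" by (simp add: iff)
  qed
  from card_mono[OF _ this] have "nat \<lceil>t\<rceil> - 1 \<le> card {k\<in>{1..N}. 2 ^ k < p}" by simp
  then have lo: "t - 1 \<le> real (card {k\<in>{1..N}. 2 ^ k < p})" using t1 by linarith
  moreover have "real (card {k\<in>{1..N}. 2 ^ k < p}) \<le> t" using up t1 by linarith
  ultimately show ?thesis unfolding t_def by linarith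
qed

definition sum_ln_lpf :: "nat \<Rightarrow> real" where
  "sum_ln_lpf n = (\<Sum>j\<in>{2..n}. ln (real (lpf j)))"

theorem sum_ln_lpf_asymp:
  "(\<lambda>n. sum_ln_lpf n / (real n * ln (ln (real n)))) \<longlonglongrightarrow> exp (- euler_mascheroni)"
proof -
  define N where "N n = nat \<lfloor>log 2 (real n)\<rfloor>" for n :: nat
  define S where "S n = real (\<Sum>k=1..N n. card (rough k n))" for n
  have S: "(\<lambda>n. S n / (real n * ln (ln (real n)))) \<longlonglongrightarrow> exp (- euler_mascheroni) / ln 2"
    unfolding S_def N_def by (rule sum_card_rough_asymp)
  \<comment> \<open>\<open>n\<close> covers the rounding of each logarithm, and the logarithmic term
    covers the integer 1, which is counted at all \<open>N n\<close> levels.\<close>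
  have main: "\<bar>sum_ln_lpf n - ln 2 * S n\<bar> \<le> real n + 2 * ln (real n)" if n: "n \<ge> 2" for n
  proof -
    define c where "c j = card {k\<in>{1..N n}. 2 ^ k < lpf j}" for j
    have "(\<Sum>j\<in>{2..n}. c j) = (\<Sum>j\<in>{2..n}. \<Sum>k\<in>{k\<in>{1..N n}. 2 ^ k < lpf j}. 1)"
      by (simp add: c_def)
    also have "\<dots> = (\<Sum>k\<in>{1..N n}. \<Sum>j\<in>{j\<in>{2..n}. 2 ^ k < lpf j}. 1)"
      by (rule sum.swap_restrict) auto
    also have "\<dots> = (\<Sum>k=1..N n. card (rough k n - {1}))"
      by (simp only: rough_eq_lpf card_eq_sum)
    finally have c_sum: "(\<Sum>j\<in>{2..n}. c j) = (\<Sum>k=1..N n. card (rough k n - {1}))" .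
    have one: "card (rough k n) = card (rough k n - {1}) + 1" for k
    proof -
      have "1 \<in> rough k n" using n by (auto simp: rough_def coprime_to_def primes_le_iff)
      then show ?thesis by (metis Suc_eq_plus1 card_Suc_Diff1 finite_rough)
    qed
    have S_eq: "S n = real (\<Sum>j\<in>{2..n}. c j) + real (N n)"
      unfolding S_def c_sum one sum.distrib by simp
    have "\<bar>ln (real (lpf j)) - ln 2 * real (c j)\<bar> \<le> ln 2" if "j \<in> {2..n}" for j
    proof -
      have "\<bar>real (c j) - log 2 (real (lpf j))\<bar> \<le> 1"
        unfolding c_def N_def using lpf_bounds[OF that] by (intro card_powers_below) auto
      then have "ln 2 * \<bar>real (c j) - log 2 (real (lpf j))\<bar> \<le> ln 2 * 1" by (intro mult_left_mono) auto
      then have "\<bar>ln 2 * (real (c j) - log 2 (real (lpf j)))\<bar> \<le> ln 2" by (simp add: abs_mult)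
      then show ?thesis by (simp add: log_def right_diff_distrib abs_minus_commute)
    qed
    then have "\<bar>\<Sum>j\<in>{2..n}. ln (real (lpf j)) - ln 2 * real (c j)\<bar> \<le> (\<Sum>j\<in>{2..n}. ln 2)"
      by (intro order_trans[OF sum_abs] sum_mono)
    also have "\<dots> = (real n - 1) * ln 2" using n by simp
    also have "\<dots> \<le> real n * 1" using n ln2_le_25_over_36 by (intro mult_mono) auto
    finally have "\<bar>sum_ln_lpf n - ln 2 * real (\<Sum>j\<in>{2..n}. c j)\<bar> \<le> real n"
      by (simp add: sum_ln_lpf_def sum_subtractf sum_distrib_left)
    moreover have "ln 2 * real (N n) \<le> 2 * ln (real n)"
    proof -
      have "real (N n) \<le> log 2 (real n)" using n by (simp add: N_def)
      then have "ln 2 * real (N n) \<le> ln (real n)" by (simp add: log_def pos_le_divide_eq mult.commute)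
      moreover have "ln (real n) \<ge> 0" using n by simp
      ultimately show ?thesis by linarith
    qed
    moreover have "ln 2 * real (N n) \<ge> 0" by simp
    ultimately show ?thesis unfolding S_eq distrib_left by linarith
  qed
  have "(\<lambda>n. sum_ln_lpf n / (real n * ln (ln (real n))) - ln 2 * (S n / (real n * ln (ln (real n))))) \<longlonglongrightarrow> 0"
  proof (rule Lim_null_comparison)
    have "\<forall>\<^sub>F n in sequentially. n \<ge> 2 \<and> ln (ln (real n)) > 0" by (intro eventually_conj; real_asymp)
    then show "\<forall>\<^sub>F n in sequentially. norm (sum_ln_lpf n / (real n * ln (ln (real n))) - ln 2 * (S n / (real n * ln (ln (real n)))))
      \<le> (real n + 2 * ln (real n)) / (real n * ln (ln (real n)))"
    proof eventually_elim
      case (elim n)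
      then have "sum_ln_lpf n / (real n * ln (ln (real n))) - ln 2 * (S n / (real n * ln (ln (real n))))
        = (sum_ln_lpf n - ln 2 * S n) / (real n * ln (ln (real n)))"
        by (simp add: diff_divide_distrib)
      moreover have "real n * ln (ln (real n)) > 0" using elim by simp
      ultimately show ?case
        using elim main[of n] by (simp only: real_norm_def abs_divide abs_of_pos divide_right_mono less_imp_le)
    qed
    show "(\<lambda>n. (real n + 2 * ln (real n)) / (real n * ln (ln (real n)))) \<longlonglongrightarrow> 0" by real_asymp
  qed
  from tendsto_add[OF this tendsto_mult_left[OF S, of "ln 2"]] show ?thesis by simp
qed

section \<open>Counting anti-coprime permutations\<close>

lemma finite_anti_coprime_perms: "finite (anti_coprime_perms n)"
  by (rule finite_subset[OF _ finite_permutations[of "{1..n}"]]) (auto simp: anti_coprime_perms_def)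

lemma num_anti_coprime_pos: "num_anti_coprime n > 0"
proof -
  have "id \<in> anti_coprime_perms n" by (auto simp: anti_coprime_perms_def permutes_id)
  then show ?thesis
    unfolding num_anti_coprime_def using finite_anti_coprime_perms by (auto simp: card_gt_0_iff)
qed

section \<open>Upper bound for the number of permutations\<close>

text \<open>Injectivity of the permutation is discarded and the values are chosen independently.
  Index 1 is unconstrained, hence its factor \<open>n\<close>. Restriction to \<open>{1..n}\<close>
  embeds the permutations into the extensional product.\<close>

lemma num_anti_coprime_le_prod:
  "num_anti_coprime n \<le> (\<Prod>j\<in>{1..n}. if j = 1 then n else card {k\<in>{1..n}. gcd j k > 1})"
proof -
  define B where "B j = (if j = 1 then {1..n} else {k\<in>{1..n}. gcd j k > 1})" for j
  have "inj_on (\<lambda>\<pi>. restrict \<pi> {1..n}) (anti_coprime_perms n)"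
  proof (rule inj_onI, rule ext)
    fix \<pi> \<rho> j
    assume *: "\<pi> \<in> anti_coprime_perms n" "\<rho> \<in> anti_coprime_perms n" "restrict \<pi> {1..n} = restrict \<rho> {1..n}"
    show "\<pi> j = \<rho> j"
    proof (cases "j \<in> {1..n}")
      case True
      with *(3) show ?thesis by (metis restrict_apply')
    next
      case False
      with *(1,2) show ?thesis by (auto simp: anti_coprime_perms_def permutes_not_in)
    qed
  qed
  moreover have "(\<lambda>\<pi>. restrict \<pi> {1..n}) ` anti_coprime_perms n \<subseteq> PiE {1..n} B"
  proof (intro image_subsetI restrict_PiE_iff[THEN iffD2] ballI)
    fix \<pi> j assume *: "\<pi> \<in> anti_coprime_perms n" "j \<in> {1..n}"
    then have "\<pi> j \<in> {1..n}" by (simp only: anti_coprime_perms_def mem_Collect_eq permutes_in_image)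
    with * show "\<pi> j \<in> B j" by (auto simp: B_def anti_coprime_perms_def)
  qed
  ultimately have "num_anti_coprime n \<le> card (PiE {1..n} B)"
    unfolding num_anti_coprime_def
    by (intro card_inj_on_le) (auto intro!: finite_PiE simp: B_def)
  also have "\<dots> = (\<Prod>j\<in>{1..n}. card (B j))" by (simp add: card_PiE)
  also have "\<dots> = (\<Prod>j\<in>{1..n}. if j = 1 then n else card {k\<in>{1..n}. gcd j k > 1})"
    by (intro prod.cong) (auto simp: B_def)
  finally show ?thesis .
qed

text \<open>Union bound over the primes dividing \<open>j\<close>, each of which is at least
  \<open>lpf j\<close>.\<close>

lemma card_not_coprime_le:
  assumes "j \<ge> 2"
  shows "real (card {k\<in>{1..n}. gcd j k > 1}) \<le> real n * real (card (prime_factors j)) / real (lpf j)"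
proof -
  have "{k\<in>{1..n}. gcd j k > 1} \<subseteq> (\<Union>p\<in>prime_factors j. {k\<in>{1..n}. p dvd k})"
  proof
    fix k assume k: "k \<in> {k\<in>{1..n}. gcd j k > 1}"
    then obtain p where "prime p" "p dvd gcd j k" using prime_factor_nat[of "gcd j k"] by auto
    with k assms show "k \<in> (\<Union>p\<in>prime_factors j. {k\<in>{1..n}. p dvd k})"
      by (auto simp: in_prime_factors_iff)
  qed
  then have "card {k\<in>{1..n}. gcd j k > 1} \<le> card (\<Union>p\<in>prime_factors j. {k\<in>{1..n}. p dvd k})"
    by (intro card_mono) auto
  also have "\<dots> \<le> (\<Sum>p\<in>prime_factors j. card {k\<in>{1..n}. p dvd k})"
    by (intro card_UN_le) auto
  finally have "real (card {k\<in>{1..n}. gcd j k > 1}) \<le> (\<Sum>p\<in>prime_factors j. real (card {k\<in>{1..n}. p dvd k}))"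
    using of_nat_le_iff[where 'a = real] by (simp only: of_nat_sum [symmetric])
  also have "\<dots> \<le> (\<Sum>p\<in>prime_factors j. real n / real (lpf j))"
  proof (rule sum_mono)
    fix p assume "p \<in> prime_factors j"
    then have p: "prime p" "p dvd j" by (auto simp: in_prime_factors_iff)
    have "real (card {k\<in>{1..n}. p dvd k}) \<le> real n / real p"
      using p prime_gt_0_nat by (subst card_multiples) (auto intro: of_nat_div_le_of_nat)
    also have "\<dots> \<le> real n / real (lpf j)"
      using lpf_le[OF p] prime_gt_0_nat[OF prime_lpf[OF assms]] by (intro divide_left_mono) auto
    finally show "real (card {k\<in>{1..n}. p dvd k}) \<le> real n / real (lpf j)" .
  qed
  finally show ?thesis by (simp add: mult.commute)
qed

text \<open>Exchanging sums leaves \<open>n\<close> times the sum of \<open>1 / p\<close>, which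
  \<open>mertens_sum\<close> dominates. The \<open>+ 1\<close> inside the logarithm comes from
  rounding \<open>log 2 n\<close> up.\<close>

lemma sum_card_prime_factors_le:
  "\<exists>B\<ge>0. \<forall>n\<ge>2. (\<Sum>j\<in>{2..n}. real (card (prime_factors j))) \<le> real n * (ln (log 2 (real n) + 1) + B)"
proof -
  obtain B where B: "B \<ge> 0" "\<And>K. \<bar>mertens_sum K - ln (real K)\<bar> \<le> B" using mertens_sum_bounded by blast
  have "(\<Sum>j\<in>{2..n}. real (card (prime_factors j))) \<le> real n * (ln (log 2 (real n) + 1) + B)" if n: "n \<ge> 2" for n
  proof -
    define N where "N = nat \<lceil>log 2 (real n)\<rceil>"
    have "log 2 2 \<le> log 2 (real n)" using n by (subst log_le_cancel_iff) auto
    then have N: "log 2 (real n) \<le> real N" "real N \<le> log 2 (real n) + 1" "1 \<le> real N" by (auto simp: N_def)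
    have "real n \<le> 2 powr real N" using N(1) n by (subst (asm) log_le_iff) auto
    then have "real n \<le> real (2 ^ N)" by (simp add: powr_realpow)
    then have nN: "n \<le> 2 ^ N" using of_nat_le_iff by blast
    have "(\<Sum>j\<in>{2..n}. real (card (prime_factors j))) = (\<Sum>j\<in>{2..n}. \<Sum>p\<in>{p\<in>primes_le n. p dvd j}. 1)"
    proof (rule sum.cong)
      fix j assume j: "j \<in> {2..n}"
      have "prime_factors j = {p\<in>primes_le n. p dvd j}"
      proof (intro equalityI subsetI)
        fix p assume "p \<in> prime_factors j"
        then have "prime p" "p dvd j" by (auto simp: in_prime_factors_iff)
        moreover from this have "p \<le> j" using j by (intro dvd_imp_le) auto
        ultimately show "p \<in> {p\<in>primes_le n. p dvd j}" using j by (simp add: primes_le_iff)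
      next
        fix p assume "p \<in> {p\<in>primes_le n. p dvd j}"
        then show "p \<in> prime_factors j" using j by (auto simp: in_prime_factors_iff primes_le_iff)
      qed
      then show "real (card (prime_factors j)) = (\<Sum>p\<in>{p\<in>primes_le n. p dvd j}. 1)" by simp
    qed simp
    also have "\<dots> = (\<Sum>p\<in>primes_le n. \<Sum>j\<in>{j\<in>{2..n}. p dvd j}. 1)"
      by (rule sum.swap_restrict) auto
    also have "\<dots> \<le> (\<Sum>p\<in>primes_le n. real n * (- ln (1 - 1 / real p)))"
    proof (rule sum_mono)
      fix p assume p: "p \<in> primes_le n"
      have p2: "real p \<ge> 2" by (rule primes_le_ge_2[OF p])
      have "card {j\<in>{2..n}. p dvd j} \<le> card {j\<in>{1..n}. p dvd j}" by (intro card_mono) auto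
      also have "\<dots> = n div p" using p2 by (intro card_multiples) simp
      finally have "real (card {j\<in>{2..n}. p dvd j}) \<le> real (n div p)" by (simp only: of_nat_le_iff)
      also have "\<dots> \<le> real n * (1 / real p)" using of_nat_div_le_of_nat[of n p, where 'a = real] by simp
      also have "\<dots> \<le> real n * (- ln (1 - 1 / real p))"
        using one_minus_prime_bounds(1)[of "real p" 1] p2 by (intro mult_left_mono) auto
      finally show "(\<Sum>j\<in>{j\<in>{2..n}. p dvd j}. 1) \<le> real n * (- ln (1 - 1 / real p))" by simp
    qed
    also have "\<dots> \<le> (\<Sum>p\<in>primes_le (2 ^ N). real n * (- ln (1 - 1 / real p)))"
    proof (rule sum_mono2)
      fix p assume "p \<in> primes_le (2 ^ N) - primes_le n"
      then have p2: "real p \<ge> 2" using primes_le_ge_2 by blast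
      then have "0 \<le> 1 / real p" "1 / real p \<le> - ln (1 - 1 / real p)"
        using one_minus_prime_bounds(1)[of "real p" 1] by auto
      then have "0 \<le> - ln (1 - 1 / real p)" by linarith
      then show "0 \<le> real n * (- ln (1 - 1 / real p))" by (intro mult_nonneg_nonneg) auto
    qed (use nN primes_le_mono in auto)
    also have "\<dots> = real n * mertens_sum N" by (simp add: mertens_sum_def sum_distrib_left)
    also have "\<dots> \<le> real n * (ln (log 2 (real n) + 1) + B)"
    proof (intro mult_left_mono)
      have "mertens_sum N \<le> ln (real N) + B" using B(2)[of N] by linarith
      also have "ln (real N) \<le> ln (log 2 (real n) + 1)" using N by simp
      finally show "mertens_sum N \<le> ln (log 2 (real n) + 1) + B" by simp
    qed simp
    finally show ?thesis .
  qed
  with B(1) show ?thesis by blast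
qed

lemma ln_fact_eq: "ln (fact n :: real) = (\<Sum>m\<in>{1..n}. ln (real m))"
  unfolding fact_prod of_nat_prod by (subst ln_prod) auto

text \<open>The product bound produces the logarithm of the number of prime factors, but only the
  mean of that number is at hand. \<open>D\<close> is a free point of linearisation, later set to
  \<open>ln (ln n)\<close>.\<close>

lemma ln_fact_minus_ln_fact_minus_ln_num_anti_coprime_le:
  "\<exists>B\<ge>0. \<forall>n\<ge>2. \<forall>D>0. ln (fact n) - ln (real (num_anti_coprime n))
    \<ge> sum_ln_lpf n - real n - real n * ((ln (log 2 (real n) + 1) + B) / D) - real n * \<bar>ln D\<bar>"
proof -
  obtain B where B: "B \<ge> 0" "\<And>n. n \<ge> 2 \<Longrightarrow> (\<Sum>j\<in>{2..n}. real (card (prime_factors j))) \<le> real n * (ln (log 2 (real n) + 1) + B)"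
    using sum_card_prime_factors_le by blast
  have "ln (fact n) - ln (real (num_anti_coprime n))
    \<ge> sum_ln_lpf n - real n - real n * ((ln (log 2 (real n) + 1) + B) / D) - real n * \<bar>ln D\<bar>"
    if n: "n \<ge> 2" and D: "D > 0" for n D
  proof -
    define r where "r j = (if j = 1 then n else card {k\<in>{1..n}. gcd j k > 1})" for j
    have r_pos: "r j > 0" if "j \<in> {1..n}" for j
    proof (cases "j = 1")
      case False
      then have "j \<in> {k\<in>{1..n}. gcd j k > 1}" using that by auto
      then have "card {k\<in>{1..n}. gcd j k > 1} > 0" by (subst card_gt_0_iff) auto
      with False show ?thesis by (simp add: r_def)
    qed (use n in \<open>simp add: r_def\<close>)
    have "real (num_anti_coprime n) \<le> real (\<Prod>j\<in>{1..n}. r j)"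
      unfolding r_def using num_anti_coprime_le_prod of_nat_le_iff by blast
    then have "ln (real (num_anti_coprime n)) \<le> ln (real (\<Prod>j\<in>{1..n}. r j))"
      using num_anti_coprime_pos[of n] by (intro ln_mono) auto
    also have "\<dots> = (\<Sum>j\<in>{1..n}. ln (real (r j)))"
      unfolding of_nat_prod using r_pos by (subst ln_prod) (auto simp: less_imp_neq)
    also have "{1..n} = insert 1 {2..n}" using n by auto
    \<comment> \<open>The free choice at 1 supplies the \<open>ln n\<close> that completes
      \<open>(n - 1) * ln n\<close> to the leading term of \<open>ln (fact n)\<close>.\<close>
    also have "(\<Sum>j\<in>insert 1 {2..n}. ln (real (r j))) = ln (real n) + (\<Sum>j\<in>{2..n}. ln (real (r j)))"
      by (simp add: r_def)
    also have "(\<Sum>j\<in>{2..n}. ln (real (r j))) \<le> (\<Sum>j\<in>{2..n}. ln (real n) + (real (card (prime_factors j)) / D + \<bar>ln D\<bar>) - ln (real (lpf j)))"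
    proof (rule sum_mono)
      fix j assume j: "j \<in> {2..n}"
      then have j2: "j \<ge> 2" by simp
      define w where "w = real (card (prime_factors j))"
      have l: "real (lpf j) > 0" using lpf_bounds[OF j] by simp
      have "lpf j \<in> prime_factors j" using prime_lpf[OF j2] lpf_dvd[OF j2] j2 by (auto simp: in_prime_factors_iff)
      then have w: "w > 0" by (auto simp: w_def card_gt_0_iff)
      have "real (r j) \<le> real n * w / real (lpf j)"
        using card_not_coprime_le[OF j2, of n] j by (simp add: r_def w_def)
      moreover have "real (r j) > 0" using r_pos[of j] j by simp
      ultimately have "ln (real (r j)) \<le> ln (real n * w / real (lpf j))" by (intro ln_mono) auto
      also have "\<dots> = ln (real n) + ln w - ln (real (lpf j))"
        using n w l by (simp add: ln_mult ln_div)
      \<comment> \<open>The tangent to the logarithm at \<open>D\<close>.\<close>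
      also have "ln w \<le> w / D + \<bar>ln D\<bar>"
      proof -
        have "ln (w / D) \<le> w / D - 1" using w D by (intro ln_le_minus_one) auto
        then show ?thesis using w D by (simp add: ln_div)
      qed
      finally show "ln (real (r j)) \<le> ln (real n) + (real (card (prime_factors j)) / D + \<bar>ln D\<bar>) - ln (real (lpf j))"
        by (simp add: w_def)
    qed
    also have "\<dots> = (real n - 1) * (ln (real n) + \<bar>ln D\<bar>) + (\<Sum>j\<in>{2..n}. real (card (prime_factors j))) / D - sum_ln_lpf n"
      using n by (simp add: sum.distrib sum_subtractf sum_ln_lpf_def sum_divide_distrib algebra_simps)
    also have "\<dots> \<le> (real n - 1) * (ln (real n) + \<bar>ln D\<bar>) + real n * (ln (log 2 (real n) + 1) + B) / D - sum_ln_lpf n"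
      using B(2)[OF n] D by (intro diff_right_mono add_left_mono divide_right_mono) auto
    finally have "ln (real (num_anti_coprime n)) \<le> real n * ln (real n) + (real n - 1) * \<bar>ln D\<bar>
        + real n * ((ln (log 2 (real n) + 1) + B) / D) - sum_ln_lpf n"
      by (simp add: algebra_simps)
    moreover have "(real n - 1) * \<bar>ln D\<bar> \<le> real n * \<bar>ln D\<bar>" by (intro mult_right_mono) auto
    ultimately show ?thesis using sum_ln_bounds(2)[of n] unfolding ln_fact_eq by linarith
  qed
  with B(1) show ?thesis by blast
qed

section \<open>Lower bound from permutations that preserve the least prime factor\<close>

text \<open>The fibres can be permuted independently. Adding a fibre composes with its permutations;
  these have support disjoint from the earlier ones, so the composition determines both
  factors.\<close>

lemma prod_fact_card_fibres_le:
  fixes f :: "'a \<Rightarrow> 'b"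
  assumes "finite X" "finite Q"
  shows "(\<Prod>y\<in>Q. fact (card {x\<in>X. f x = y})) \<le> card {\<pi>. \<pi> permutes {x\<in>X. f x \<in> Q} \<and> (\<forall>x. f (\<pi> x) = f x)}"
  using assms(2)
proof (induction Q rule: finite_induct)
  case empty
  have "{\<pi>. \<pi> permutes {x\<in>X. f x \<in> {}} \<and> (\<forall>x. f (\<pi> x) = f x)} = {id}" by auto
  then show ?case by simp
next
  case (insert y Q)
  define G where "G R = {\<pi>. \<pi> permutes {x\<in>X. f x \<in> R} \<and> (\<forall>x. f (\<pi> x) = f x)}" for R
  define F where "F = {x\<in>X. f x = y}"
  have fin: "finite (G R)" for R
    unfolding G_def using assms(1)
    by (intro finite_subset[OF _ finite_permutations[of "{x\<in>X. f x \<in> R}"]]) auto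
  have F_fixed: "f (\<tau> x) = f x" if "\<tau> permutes F" for \<tau> x
    using permutes_in_image[OF that, of x] permutes_not_in[OF that, of x] by (cases "x \<in> F") (auto simp: F_def)
  let ?h = "\<lambda>(\<sigma>, \<tau>). \<sigma> \<circ> \<tau>"
  have "inj_on ?h (G Q \<times> {\<tau>. \<tau> permutes F})"
  proof (rule inj_onI, safe)
    fix \<sigma> \<tau> \<sigma>' \<tau>'
    assume *: "\<sigma> \<in> G Q" "\<sigma>' \<in> G Q" "\<tau> permutes F" "\<tau>' permutes F" "\<sigma> \<circ> \<tau> = \<sigma>' \<circ> \<tau>'"
    have id_on: "\<rho> x = x" if "\<rho> \<in> G Q" "x \<in> F" for \<rho> x
      using that insert(2) by (auto simp: G_def F_def intro!: permutes_not_in)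
    have "\<tau> x = \<tau>' x" for x
    proof (cases "x \<in> F")
      case True
      then have "\<sigma> (\<tau> x) = \<tau> x" "\<sigma>' (\<tau>' x) = \<tau>' x"
        using * id_on permutes_in_image by metis+
      moreover have "\<sigma> (\<tau> x) = \<sigma>' (\<tau>' x)" using *(5) by (metis comp_apply)
      ultimately show ?thesis by simp
    next
      case False
      with * show ?thesis by (simp add: permutes_not_in)
    qed
    then show tau: "\<tau> = \<tau>'" by auto
    have "\<sigma> x = \<sigma>' x" for x
    proof -
      obtain u where "x = \<tau> u" using permutes_surj[OF *(3)] by (metis surjD)
      then show ?thesis using *(5) tau by (metis comp_apply)
    qed
    then show "\<sigma> = \<sigma>'" by auto
  qed
  moreover have "?h ` (G Q \<times> {\<tau>. \<tau> permutes F}) \<subseteq> G (insert y Q)"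
  proof
    fix \<pi> assume "\<pi> \<in> ?h ` (G Q \<times> {\<tau>. \<tau> permutes F})"
    then obtain u where u: "\<pi> = ?h u" "u \<in> G Q \<times> {\<tau>. \<tau> permutes F}" by (rule imageE)
    define \<sigma> \<tau> where "\<sigma> = fst u" and "\<tau> = snd u"
    have \<pi>: "\<pi> = \<sigma> \<circ> \<tau>" using u(1) by (simp only: \<sigma>_def \<tau>_def case_prod_unfold)
    have *: "\<sigma> \<in> G Q" "\<tau> permutes F"
      using u(2) by (simp_all only: \<sigma>_def \<tau>_def mem_Times_iff mem_Collect_eq)
    have "\<sigma> permutes {x\<in>X. f x \<in> insert y Q}"
    proof (rule permutes_subset)
      show "\<sigma> permutes {x\<in>X. f x \<in> Q}" using *(1) unfolding G_def by (rule CollectE) (rule conjunct1)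
    qed blast
    moreover have "\<tau> permutes {x\<in>X. f x \<in> insert y Q}"
      by (rule permutes_subset[OF *(2)]) (simp add: F_def subset_iff)
    ultimately have "\<pi> permutes {x\<in>X. f x \<in> insert y Q}"
      unfolding \<pi> by (intro permutes_compose)
    moreover have "f (\<pi> x) = f x" for x
    proof -
      have "\<forall>x. f (\<sigma> x) = f x" using *(1) unfolding G_def by (rule CollectE) (rule conjunct2)
      then show ?thesis using F_fixed[OF *(2), of x] unfolding \<pi> comp_apply by (metis (no_types))
    qed
    ultimately show "\<pi> \<in> G (insert y Q)" by (simp add: G_def)
  qed
  ultimately have "card (G Q \<times> {\<tau>. \<tau> permutes F}) \<le> card (G (insert y Q))"
    using fin by (intro card_inj_on_le)
  moreover have "card {\<tau>. \<tau> permutes F} = fact (card F)"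
    using assms(1) by (intro card_permutations) (auto simp: F_def)
  ultimately have "card (G Q) * fact (card F) \<le> card (G (insert y Q))"
    by (simp add: card_cartesian_product)
  moreover have "(\<Prod>y\<in>Q. fact (card {x\<in>X. f x = y})) \<le> card (G Q)" using insert by (simp add: G_def)
  ultimately have "fact (card F) * (\<Prod>y\<in>Q. fact (card {x\<in>X. f x = y})) \<le> card (G (insert y Q))"
    by (metis (no_types, lifting) mult.commute mult_le_mono1 order_trans)
  then show ?case using insert by (simp add: F_def G_def)
qed

text \<open>Permuting only \<open>{2..n}\<close> fixes 1, so the unspecified \<open>lpf 1\<close> is
  never matched with a genuine least prime factor.\<close>

lemma prod_fact_card_lpf_le_num_anti_coprime:
  "(\<Prod>p\<in>lpf ` {2..n}. fact (card {j\<in>{2..n}. lpf j = p})) \<le> num_anti_coprime n"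
proof -
  have "(\<Prod>p\<in>lpf ` {2..n}. fact (card {j\<in>{2..n}. lpf j = p}))
    \<le> card {\<pi>. \<pi> permutes {j\<in>{2..n}. lpf j \<in> lpf ` {2..n}} \<and> (\<forall>j. lpf (\<pi> j) = lpf j)}"
    by (rule prod_fact_card_fibres_le) auto
  also have "{j\<in>{2..n}. lpf j \<in> lpf ` {2..n}} = {2..n}" by auto
  also have "card {\<pi>. \<pi> permutes {2..n} \<and> (\<forall>j. lpf (\<pi> j) = lpf j)} \<le> num_anti_coprime n"
    unfolding num_anti_coprime_def
  proof (intro card_mono finite_anti_coprime_perms subsetI)
    fix \<pi> assume "\<pi> \<in> {\<pi>. \<pi> permutes {2..n} \<and> (\<forall>j. lpf (\<pi> j) = lpf j)}"
    then have \<pi>: "\<pi> permutes {2..n}" "\<And>j. lpf (\<pi> j) = lpf j" by auto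
    have "gcd j (\<pi> j) > 1" if "j \<in> {1..n}" "j \<noteq> 1" for j
    proof -
      have j: "j \<in> {2..n}" using that by auto
      then have pj: "\<pi> j \<in> {2..n}" by (simp only: permutes_in_image[OF \<pi>(1)])
      have "lpf j dvd gcd j (\<pi> j)"
        using lpf_dvd[of j] lpf_dvd[of "\<pi> j"] \<pi>(2)[of j] j pj by auto
      then have "lpf j \<le> gcd j (\<pi> j)" using j by (intro dvd_imp_le) auto
      with lpf_bounds(1)[OF j] show ?thesis by linarith
    qed
    moreover have "\<pi> permutes {1..n}" by (rule permutes_subset[OF \<pi>(1)]) auto
    ultimately show "\<pi> \<in> anti_coprime_perms n" by (simp add: anti_coprime_perms_def)
  qed
  finally show ?thesis .
qed

lemma ln_fact_minus_ln_num_anti_coprime_le: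
  assumes \<delta>: "\<delta> > 0"
  shows "\<exists>C. \<forall>n\<ge>1. ln (fact n) - ln (real (num_anti_coprime n)) \<le> (1 + \<delta>) * sum_ln_lpf n + C * real n"
proof -
  have summ: "summable (\<lambda>m. real m powr - (1 + \<delta>))"
    using \<delta> by (subst summable_real_powr_iff) auto
  define Z where "Z = (\<Sum>m. real m powr - (1 + \<delta>))"
  have "ln (fact n) - ln (real (num_anti_coprime n)) \<le> (1 + \<delta>) * sum_ln_lpf n + (Z + 2) * real n" if n: "n \<ge> 1" for n
  proof -
    define s where "s p = card {j\<in>{2..n}. lpf j = p}" for p
    define P where "P = lpf ` {2..n}"
    have finP: "finite P" by (simp add: P_def)
    have s_pos: "s p > 0" if "p \<in> P" for p
      using that unfolding P_def s_def by (auto simp: card_gt_0_iff)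
    have P_pos: "p \<ge> 2" if "p \<in> P" for p using that lpf_bounds(1) by (auto simp: P_def)
    have group: "(\<Sum>p\<in>P. real (s p) * g p) = (\<Sum>j\<in>{2..n}. g (lpf j))" for g :: "nat \<Rightarrow> real"
    proof -
      have "(\<Sum>j\<in>{2..n}. g (lpf j)) = (\<Sum>p\<in>P. \<Sum>j\<in>{j\<in>{2..n}. lpf j = p}. g (lpf j))"
        unfolding P_def by (rule sum.image_gen) simp
      also have "\<dots> = (\<Sum>p\<in>P. real (s p) * g p)"
        by (rule sum.cong) (auto simp: s_def)
      finally show ?thesis by simp
    qed
    have "real (\<Prod>p\<in>P. fact (s p)) \<le> real (num_anti_coprime n)"
      unfolding P_def s_def using prod_fact_card_lpf_le_num_anti_coprime of_nat_le_iff by blast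
    moreover have "real (\<Prod>p\<in>P. fact (s p)) = (\<Prod>p\<in>P. fact (s p))" by simp
    ultimately have "ln (\<Prod>p\<in>P. fact (s p) :: real) \<le> ln (real (num_anti_coprime n))"
      by (intro ln_mono prod_pos) auto
    also have "ln (\<Prod>p\<in>P. fact (s p) :: real) = (\<Sum>p\<in>P. ln (fact (s p)))"
      using finP by (intro ln_prod) auto
    finally have A: "(\<Sum>p\<in>P. ln (fact (s p))) \<le> ln (real (num_anti_coprime n))" .
    have "(\<Sum>p\<in>P. real (s p) * ln (real n) - ln (fact (s p)))
      \<le> (\<Sum>p\<in>P. real (s p) * ((1 + \<delta>) * ln (real p)) + real n * real p powr - (1 + \<delta>))"
    proof (rule sum_mono)
      fix p assume p: "p \<in> P"
      have sp: "real (s p) > 0" using s_pos[OF p] by simp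
      have p2: "real p \<ge> 2" using P_pos[OF p] by simp
      let ?r = "real p powr - (1 + \<delta>)"
      have r: "?r > 0" using p2 by simp
      \<comment> \<open>Gibbs' inequality term by term: the fibre size \<open>s p\<close> is
        compared with the unnormalised weight \<open>n * p powr - (1 + \<delta>)\<close>. Summed
        over the fibres, the weights cost at most \<open>n * Z\<close>.\<close>
      have "ln (real n * ?r / real (s p)) \<le> real n * ?r / real (s p) - 1"
        using n r sp by (intro ln_le_minus_one) auto
      moreover have "ln (real n * ?r / real (s p)) = ln (real n) - (1 + \<delta>) * ln (real p) - ln (real (s p))"
        using n r sp p2 by (simp add: ln_div ln_mult_pos ln_powr algebra_simps)
      ultimately have "ln (real n) - ln (real (s p)) + 1 \<le> (1 + \<delta>) * ln (real p) + real n * ?r / real (s p)"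
        by linarith
      then have "real (s p) * (ln (real n) - ln (real (s p)) + 1) \<le> real (s p) * ((1 + \<delta>) * ln (real p) + real n * ?r / real (s p))"
        using sp by (intro mult_left_mono) auto
      then have "real (s p) * ln (real n) - (real (s p) * ln (real (s p)) - real (s p)) \<le> real (s p) * ((1 + \<delta>) * ln (real p)) + real n * ?r"
        using sp by (simp add: distrib_left right_diff_distrib)
      \<comment> \<open>The \<open>- s p\<close> of this crude Stirling bound is matched by the
        \<open>- 1\<close> in \<open>ln x \<le> x - 1\<close>, multiplied by
        \<open>s p\<close>.\<close>
      moreover have "real (s p) * ln (real (s p)) - real (s p) \<le> ln (fact (s p))"
        unfolding ln_fact_eq by (rule sum_ln_bounds)
      ultimately show "real (s p) * ln (real n) - ln (fact (s p)) \<le> real (s p) * ((1 + \<delta>) * ln (real p)) + real n * ?r"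
        by linarith
    qed
    also have "\<dots> = (1 + \<delta>) * sum_ln_lpf n + real n * (\<Sum>p\<in>P. real p powr - (1 + \<delta>))"
      unfolding sum.distrib group by (simp add: sum_ln_lpf_def sum_distrib_left)
    also have "\<dots> \<le> (1 + \<delta>) * sum_ln_lpf n + real n * Z"
      unfolding Z_def using finP summ by (intro add_left_mono mult_left_mono sum_le_suminf) auto
    finally have "(\<Sum>p\<in>P. real (s p) * ln (real n)) - (\<Sum>p\<in>P. ln (fact (s p))) \<le> (1 + \<delta>) * sum_ln_lpf n + real n * Z"
      by (simp add: sum_subtractf)
    \<comment> \<open>The fibres cover \<open>n - 1\<close> integers; the missing
      \<open>ln n\<close> is absorbed by the multiple of \<open>n\<close>.\<close>
    moreover have "(\<Sum>p\<in>P. real (s p) * ln (real n)) = (real n - 1) * ln (real n)"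
      unfolding group using n by (cases n) simp_all
    moreover have "ln (fact n) \<le> real n * ln (real n)" unfolding ln_fact_eq by (rule sum_ln_bounds)
    moreover have "ln (real n) \<le> real n" using n ln_le_minus_one[of "real n"] by simp
    ultimately show ?thesis using A by (simp add: algebra_simps)
  qed
  then show ?thesis by blast
qed

section \<open>The asymptotic formula\<close>

lemma ln_fact_minus_ln_num_anti_coprime_asymp:
  "(\<lambda>n. (ln (fact n) - ln (real (num_anti_coprime n))) / (real n * ln (ln (real n)))) \<longlonglongrightarrow> exp (- euler_mascheroni)"
proof -
  define D where "D n = (ln (fact n) - ln (real (num_anti_coprime n))) / (real n * ln (ln (real n)))" for n
  define L where "L n = sum_ln_lpf n / (real n * ln (ln (real n)))" for n
  have L: "L \<longlonglongrightarrow> exp (- euler_mascheroni)" unfolding L_def by (rule sum_ln_lpf_asymp)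
  have ev: "\<forall>\<^sub>F n in sequentially. n \<ge> 2 \<and> ln (ln (real n)) > 1" by (intro eventually_conj; real_asymp)
  obtain B where B: "\<And>n d. n \<ge> 2 \<Longrightarrow> d > 0 \<Longrightarrow> ln (fact n) - ln (real (num_anti_coprime n))
    \<ge> sum_ln_lpf n - real n - real n * ((ln (log 2 (real n) + 1) + B) / d) - real n * \<bar>ln d\<bar>"
    using ln_fact_minus_ln_fact_minus_ln_num_anti_coprime_le by blast
  \<comment> \<open>The previous bound at \<open>d = ln (ln n)\<close>: the mean number of prime
    factors over \<open>d\<close> stays bounded, and \<open>ln d\<close> is of smaller order than
    the outer denominator.\<close>
  define err where "err n = (1 + (ln (log 2 (real n) + 1) + B) / ln (ln (real n)) + ln (ln (ln (real n)))) / ln (ln (real n))" for n :: nat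
  have err: "err \<longlonglongrightarrow> 0" unfolding err_def log_def by real_asymp
  have low: "\<forall>\<^sub>F n in sequentially. L n - err n \<le> D n"
    using ev
  proof eventually_elim
    case (elim n)
    define m where "m = ln (ln (real n))"
    have m: "m > 1" "n \<ge> 2" using elim by (auto simp: m_def)
    then have pos: "real n * m > 0" by (intro mult_pos_pos) auto
    have "sum_ln_lpf n - real n * (1 + (ln (log 2 (real n) + 1) + B) / m + ln m) \<le> ln (fact n) - ln (real (num_anti_coprime n))"
      using B[of n m] m by (simp add: distrib_left)
    then have "(sum_ln_lpf n - real n * (1 + (ln (log 2 (real n) + 1) + B) / m + ln m)) / (real n * m) \<le> D n"
      unfolding D_def m_def [symmetric] using pos by (intro divide_right_mono) auto
    also have "(sum_ln_lpf n - real n * (1 + (ln (log 2 (real n) + 1) + B) / m + ln m)) / (real n * m) = L n - err n"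
      using m by (simp add: L_def err_def m_def [symmetric] diff_divide_distrib)
    finally show ?case .
  qed
  have "(\<lambda>n. L n - err n) \<longlonglongrightarrow> exp (- euler_mascheroni) - 0" by (intro tendsto_diff L err)
  then have low_lim: "(\<lambda>n. L n - err n) \<longlonglongrightarrow> exp (- euler_mascheroni)" by simp
  have "D \<longlonglongrightarrow> exp (- euler_mascheroni)"
  proof (rule order_tendstoI)
    fix a :: real assume "a < exp (- euler_mascheroni)"
    then have "\<forall>\<^sub>F n in sequentially. a < L n - err n" by (rule order_tendstoD[OF low_lim])
    with low show "\<forall>\<^sub>F n in sequentially. a < D n" by eventually_elim linarith
  next
    fix a :: real assume a: "exp (- euler_mascheroni) < a"
    define e where "e = exp (- euler_mascheroni :: real)"
    have e: "e > 0" "e < a" using a by (auto simp: e_def)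
    \<comment> \<open>Makes \<open>(1 + \<delta>) * e\<close> the midpoint of \<open>e\<close> and
      \<open>a\<close>. \<delta> stays fixed while \<open>n\<close> grows, because \<open>C\<close>
      depends on it.\<close>
    define \<delta> where "\<delta> = (a - e) / (2 * e)"
    have \<delta>: "\<delta> > 0" "(1 + \<delta>) * e < a" using e by (auto simp: \<delta>_def field_simps)
    obtain C where C: "\<And>n. n \<ge> 1 \<Longrightarrow> ln (fact n) - ln (real (num_anti_coprime n)) \<le> (1 + \<delta>) * sum_ln_lpf n + C * real n"
      using ln_fact_minus_ln_num_anti_coprime_le[OF \<delta>(1)] by blast
    have "(\<lambda>n. (1 + \<delta>) * L n + C * (1 / ln (ln (real n)))) \<longlonglongrightarrow> (1 + \<delta>) * e + C * 0"
      unfolding e_def by (intro tendsto_intros L) real_asymp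
    then have "\<forall>\<^sub>F n in sequentially. (1 + \<delta>) * L n + C * (1 / ln (ln (real n))) < a"
      by (rule order_tendstoD) (use \<delta> in simp)
    with ev show "\<forall>\<^sub>F n in sequentially. D n < a"
    proof eventually_elim
      case (elim n)
      define m where "m = ln (ln (real n))"
      have m: "m > 1" "n \<ge> 2" using elim by (auto simp: m_def)
      then have pos: "real n * m > 0" by (intro mult_pos_pos) auto
      have "D n \<le> ((1 + \<delta>) * sum_ln_lpf n + C * real n) / (real n * m)"
        unfolding D_def m_def [symmetric] using C[of n] m pos by (intro divide_right_mono) auto
      also have "\<dots> = (1 + \<delta>) * L n + C * (1 / m)"
        using m by (simp add: L_def m_def [symmetric] add_divide_distrib)
      also have "\<dots> < a" using elim by (simp add: m_def)
      finally show ?case .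
    qed
  qed
  then show ?thesis by (simp add: D_def[abs_def])
qed

theorem theorem6:
  shows "\<exists>\<epsilon> :: nat \<Rightarrow> real. \<epsilon> \<in> o(\<lambda>_. 1) \<and>
    (\<forall>\<^sub>F n in sequentially.
       real (num_anti_coprime n) =
         fact n / ln (real n) powr ((exp (- euler_mascheroni) + \<epsilon> n) * real n))"
proof -
  define D where "D n = (ln (fact n) - ln (real (num_anti_coprime n))) / (real n * ln (ln (real n)))" for n
  \<comment> \<open>The claimed identity solved for \<epsilon>, so that the formula is exact once
    \<open>ln (ln n) > 0\<close>.\<close>
  define \<epsilon> where "\<epsilon> n = D n - exp (- euler_mascheroni)" for n
  have "D \<longlonglongrightarrow> exp (- euler_mascheroni)"
    unfolding D_def by (rule ln_fact_minus_ln_num_anti_coprime_asymp)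
  then have "\<epsilon> \<longlonglongrightarrow> exp (- euler_mascheroni) - exp (- euler_mascheroni)"
    unfolding \<epsilon>_def by (intro tendsto_intros)
  then have "\<epsilon> \<in> o(\<lambda>_. 1)" by (intro smalloI_tendsto) simp_all
  moreover have "\<forall>\<^sub>F n in sequentially. n \<ge> 2 \<and> ln (real n) > 0 \<and> ln (ln (real n)) > 0"
    by (intro eventually_conj; real_asymp)
  then have "\<forall>\<^sub>F n in sequentially. real (num_anti_coprime n) =
         fact n / ln (real n) powr ((exp (- euler_mascheroni) + \<epsilon> n) * real n)"
  proof eventually_elim
    case (elim n)
    have A: "real (num_anti_coprime n) > 0" using num_anti_coprime_pos by simp
    have "ln (real n) powr ((exp (- euler_mascheroni) + \<epsilon> n) * real n) = exp (D n * (real n * ln (ln (real n))))"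
    proof -
      have "exp (- euler_mascheroni) + \<epsilon> n = D n" by (simp add: \<epsilon>_def)
      then show ?thesis using elim by (simp only: powr_def mult.assoc) simp
    qed
    also have "D n * (real n * ln (ln (real n))) = ln (fact n) - ln (real (num_anti_coprime n))"
    proof -
      \<comment> \<open>Otherwise the denominator in \<open>D\<close> would vanish and the quotient
        would be 0 by convention.\<close>
      have "ln (real n) \<noteq> 1" using elim by auto
      then show ?thesis using elim by (simp add: D_def)
    qed
    also have "exp (ln (fact n) - ln (real (num_anti_coprime n))) = fact n / real (num_anti_coprime n)"
      using A by (simp add: exp_diff)
    finally show ?case using A by simp
  qed
  ultimately show ?thesis by blast
qed

end
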